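(* Let $r\in(0,1)$ and let the weights $\omega_x$ be i.i.d. $\mathrm{Geom}(r)$. For any $\delta\in(0,r)$ and $\kappa\ge0$ there exist positive finite constants $c_0=c_0(\delta,r)$, $N_0=N_0(\delta,r,\kappa)$ and $s_0=s_0(\delta,r,\kappa)$ such that $$\mathbb P\bigl\{|Z^{\xi,\mathbf e_1}(m,n)|\vee|Z^{\xi,\mathbf e_2}(m,n)|\ge s(m+n)^{2/3}\bigr\}\le\exp\{-c_0s^3\}$$ for all $(m,n)\in S_\delta\cap\mathbb Z^2_{\ge N_0}$, $s\ge s_0$, and $\xi\in\mathrm{ri}\,\mathcal U$ such that $\xi_1\in(\delta,1-\delta)$ and $|\xi_1-\frac m{m+n}|\le\kappa(m+n)^{-1/3}$.
   Context: $\mathbf e_1=(1,0)$, $\mathbf e_2=(0,1)$. $X\sim\mathrm{Geom}(p)$ means $\mathbb P(X=n)=p^n(1-p)$, $n\in\mathbb Z_{\ge0}$. $\mathrm{ri}\,\mathcal U=\{t\mathbf e_1+(1-t)\mathbf e_2:0<t<1\}$; $S_\delta=\{x\in\mathbb R^2_{>0}:x_1\ge\delta x_2,\ x_2\ge\delta x_1\}$. Bulk last-passage times: for $x\le y$ (coordinatewise) in $\mathbb Z^2$, $G_{x,y}$ is the maximum of $\sum_{v\in\pi}\omega_v$ over up-right paths $\pi$ from $x$ to $y$ (steps in $\{\mathbf e_1,\mathbf e_2\}$, both endpoints included). Stationary model with southwest boundary at the origin: for $\xi\in\mathrm{ri}\,\mathcal U$ let $$p=\bar p(\xi)=\frac{r(\xi_1+\xi_2)+(r+1)\sqrt{r\xi_1\xi_2}}{\xi_1+r\xi_2+2\sqrt{r\xi_1\xi_2}}\in(r,1).$$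 The boundary weights $\{I^\xi_{i\mathbf e_1},J^\xi_{j\mathbf e_2}:i,j\ge1\}$ are mutually independent, independent of the bulk weights $\{\omega_x:x\in\mathbb N^2\}$ ($\mathbb N=\{1,2,\dots\}$), with $I^\xi_{i\mathbf e_1}\sim\mathrm{Geom}(p)$ and $J^\xi_{j\mathbf e_2}\sim\mathrm{Geom}(r/p)$. For $(m,n)\in\mathbb N^2$ put $$G^\xi(m,n)=\max_{1\le k\le m}\Bigl\{\sum_{i=1}^kI^\xi_{i\mathbf e_1}+G_{(k,1),(m,n)}\Bigr\}\vee\max_{1\le\ell\le n}\Bigl\{\sum_{j=1}^\ell J^\xi_{j\mathbf e_2}+G_{(1,\ell),(m,n)}\Bigr\}.$$ $\mathrm{Exit}^\xi(m,n)$ is the set of all $k\in\{1,\dots,m\}$ attaining $G^\xi(m,n)$ in the first family together with all $-\ell$, $\ell\in\{1,\dots,n\}$, attaining $G^\xi(m,n)$ in the second family; $Z^{\xi,\mathbf e_1}(m,n)=\max\mathrm{Exit}^\xi(m,n)$ and $Z^{\xi,\mathbf e_2}(m,n)=\min\mathrm{Exit}^\xi(m,n)$. *)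

theory Defs
  imports "HOL-Probability.Probability"
begin

section \<open>Geometric weights, directions and cones\<close>

text \<open>
  Convention: \<open>X \<sim> Geom(q)\<close> means \<open>P(X = n) = q ^ n * (1 - q)\<close> for \<open>n \<ge> 0\<close>.  The library's
  \<^const>\<open>geometric_pmf\<close> takes the success probability \<open>1 - q\<close> instead; see \<open>pmf_Geom\<close>.
\<close>

definition Geom :: "real \<Rightarrow> nat pmf" where
  "Geom q = geometric_pmf (1 - q)"

lemma pmf_Geom:
  assumes "0 \<le> q" "q < 1"
  shows "pmf (Geom q) n = q ^ n * (1 - q)"
  using assms by (simp add: Geom_def)

definition riU :: "(real \<times> real) set" where
  "riU = {t *\<^sub>R (1, 0) + (1 - t) *\<^sub>R (0, 1) | t. 0 < t \<and> t < 1}"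

definition cone_S :: "real \<Rightarrow> (real \<times> real) set" where
  "cone_S \<delta> = {x. fst x > 0 \<and> snd x > 0 \<and> fst x \<ge> \<delta> * snd x \<and> snd x \<ge> \<delta> * fst x}"

definition pbar :: "real \<Rightarrow> real \<times> real \<Rightarrow> real" where
  "pbar r \<xi> =
     (r * (fst \<xi> + snd \<xi>) + (r + 1) * sqrt (r * fst \<xi> * snd \<xi>)) /
     (fst \<xi> + r * snd \<xi> + 2 * sqrt (r * fst \<xi> * snd \<xi>))"

section \<open>Last-passage percolation\<close>

definition up_right_path :: "int \<times> int \<Rightarrow> int \<times> int \<Rightarrow> (int \<times> int) list \<Rightarrow> bool" where
  "up_right_path x y \<pi> \<longleftrightarrow>
     \<pi> \<noteq> [] \<and> hd \<pi> = x \<and> last \<pi> = y \<and> successively (\<lambda>u v. v = u + (1, 0) \<or> v = u + (0, 1)) \<pi>"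

text \<open>
  The maximum ranges over a finite set, nonempty when \<open>x \<le> y\<close> coordinatewise; other pairs
  \<open>x, y\<close> are never used.
\<close>

definition lpt :: "(int \<times> int \<Rightarrow> nat) \<Rightarrow> int \<times> int \<Rightarrow> int \<times> int \<Rightarrow> nat" where
  "lpt w x y = Max {sum_list (map w \<pi>) | \<pi>. up_right_path x y \<pi>}"

text \<open>
  Values of the two families, for a realization \<open>w\<close> of the bulk weights, \<open>a\<close> of the weights
  on the horizontal axis and \<open>b\<close> of the weights on the vertical axis. The boundary weights are
  indexed by their sites \<open>(i, 0)\<close> and \<open>(0, j)\<close>.
\<close>

definition exit_val1 ::
  "(int \<times> int \<Rightarrow> nat) \<Rightarrow> (int \<times> int \<Rightarrow> nat) \<Rightarrow> int \<Rightarrow> int \<Rightarrow> int \<Rightarrow> nat" where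
  "exit_val1 w a m n k = (\<Sum>i=1..k. a (i, 0)) + lpt w (k, 1) (m, n)"

definition exit_val2 ::
  "(int \<times> int \<Rightarrow> nat) \<Rightarrow> (int \<times> int \<Rightarrow> nat) \<Rightarrow> int \<Rightarrow> int \<Rightarrow> int \<Rightarrow> nat" where
  "exit_val2 w b m n l = (\<Sum>j=1..l. b (0, j)) + lpt w (1, l) (m, n)"

definition lpt_stat ::
  "(int \<times> int \<Rightarrow> nat) \<Rightarrow> (int \<times> int \<Rightarrow> nat) \<Rightarrow> (int \<times> int \<Rightarrow> nat) \<Rightarrow> int \<Rightarrow> int \<Rightarrow> nat" where
  "lpt_stat w a b m n =
     max (Max (exit_val1 w a m n ` {1..m})) (Max (exit_val2 w b m n ` {1..n}))"

definition Exit ::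
  "(int \<times> int \<Rightarrow> nat) \<Rightarrow> (int \<times> int \<Rightarrow> nat) \<Rightarrow> (int \<times> int \<Rightarrow> nat) \<Rightarrow> int \<Rightarrow> int \<Rightarrow> int set" where
  "Exit w a b m n =
     {k \<in> {1..m}. exit_val1 w a m n k = lpt_stat w a b m n} \<union>
     uminus ` {l \<in> {1..n}. exit_val2 w b m n l = lpt_stat w a b m n}"

definition Z1 ::
  "(int \<times> int \<Rightarrow> nat) \<Rightarrow> (int \<times> int \<Rightarrow> nat) \<Rightarrow> (int \<times> int \<Rightarrow> nat) \<Rightarrow> int \<Rightarrow> int \<Rightarrow> int" where
  "Z1 w a b m n = Max (Exit w a b m n)"

definition Z2 ::
  "(int \<times> int \<Rightarrow> nat) \<Rightarrow> (int \<times> int \<Rightarrow> nat) \<Rightarrow> (int \<times> int \<Rightarrow> nat) \<Rightarrow> int \<Rightarrow> int \<Rightarrow> int" where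
  "Z2 w a b m n = Min (Exit w a b m n)"

section \<open>The stationary model\<close>

definition quadrant_weight ::
  "(int \<times> int \<Rightarrow> 'a \<Rightarrow> nat) \<Rightarrow> (int \<times> int \<Rightarrow> 'a \<Rightarrow> nat) \<Rightarrow> (int \<times> int \<Rightarrow> 'a \<Rightarrow> nat) \<Rightarrow>
   int \<times> int \<Rightarrow> 'a \<Rightarrow> nat" where
  "quadrant_weight \<omega> I J v = (if snd v = 0 then I v else if fst v = 0 then J v else \<omega> v)"

text \<open>
  Assumption \<open>indep\<close> is the joint independence of the boundary weights at the sites
  \<open>(i, 0)\<close> and \<open>(0, j)\<close> with \<open>i, j \<ge> 1\<close> and the bulk weights at the sites \<open>(i, j)\<close>
  with \<open>i, j \<ge> 1\<close>.
\<close>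

locale stationary_lpp = prob_space M
  for M :: "'a measure" and r :: real and \<xi> :: "real \<times> real"
    and \<omega> I J :: "int \<times> int \<Rightarrow> 'a \<Rightarrow> nat" +
  assumes bulk_indep: "indep_vars (\<lambda>_. count_space UNIV) \<omega> UNIV"
    and bulk_law: "\<And>v. distr M (count_space UNIV) (\<omega> v) = measure_pmf (Geom r)"
    and indep: "indep_vars (\<lambda>_. count_space UNIV) (quadrant_weight \<omega> I J)
                  ({0..} \<times> {0..} - {(0, 0)})"
    and I_law: "\<And>i. i \<ge> 1 \<Longrightarrow>
                  distr M (count_space UNIV) (I (i, 0)) = measure_pmf (Geom (pbar r \<xi>))"
    and J_law: "\<And>j. j \<ge> 1 \<Longrightarrow>
                  distr M (count_space UNIV) (J (0, j)) = measure_pmf (Geom (r / pbar r \<xi>))"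

end

theory Submission
  imports Defs
begin

text \<open>
  Let \<open>P\<^bsub>a,b\<^esub>\<close> be the model with boundary weights \<open>I \<sim> Geom(a)\<close>, \<open>J \<sim> Geom(r / b)\<close>; it is
  stationary for \<open>a = b\<close>.  Burke's property at \<open>(b, b)\<close> and a change of measure on the horizontal axis
  give the exact formula
  \<open>E\<^bsub>a,b\<^esub> (b / a) ^ G(m, n) = ((1 - a) / (1 - b)) ^ m * ((1 - r / b) / (1 - r / a)) ^ n\<close>,
  whose logarithmic derivative in \<open>b\<close> is minimal at the characteristic parameter \<open>p\<close> of \<open>(m, n)\<close>, with
  quadratic growth.  It yields upper tails of \<open>G\<close> for \<open>a < b\<close> and lower tails for \<open>b < a\<close>.

  Let \<open>N = m + n\<close> and let \<open>a, b\<close> be within \<open>\<eta> * l / N\<close> of \<open>p\<close>.  If the exit point is larger than \<open>l\<close>, then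
  \<open>G\<close> is at most the sum of the first \<open>l\<close> boundary weights plus the passage time of the model started at
  \<open>(l, 0)\<close>.  The latter has mean smaller by order \<open>l\<^sup>2 / N\<close>, so that either \<open>G\<close> is too small or one of the two
  summands is too large.  The summands are controlled by exponential moments.  For the lower tail of \<open>G\<close> the
  parameter of the first \<open>2 * l\<close> boundary weights is raised to \<open>a' > b\<close>, at a cost \<open>exp (C * \<eta>\<^sup>2 * l ^ 3 / N\<^sup>2)\<close>;
  the lower tail under \<open>P\<^bsub>a',b\<^esub>\<close> is explicit, up to the event that the exit point under \<open>P\<^bsub>a',b\<^esub>\<close> is larger
  than \<open>2 * l\<close>.  By downward induction on \<open>l\<close> that event has probability at most
  \<open>exp (- 8 * c * l ^ 3 / N\<^sup>2)\<close>, which absorbs the cost.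
\<close>

section \<open>Burke's property\<close>

lemma nn_integral_pmf_swap:
  "(\<integral>\<^sup>+x. \<integral>\<^sup>+y. f x y \<partial>measure_pmf q \<partial>measure_pmf p) = (\<integral>\<^sup>+y. \<integral>\<^sup>+x. f x y \<partial>measure_pmf p \<partial>measure_pmf q)"
proof -
  have "(\<integral>\<^sup>+x. \<integral>\<^sup>+y. f x y \<partial>measure_pmf q \<partial>measure_pmf p) = (\<integral>\<^sup>+z. (case z of (x, y) \<Rightarrow> f x y) \<partial>pair_pmf p q)"
    by (simp add: nn_integral_pair_pmf')
  also have "\<dots> = (\<integral>\<^sup>+z. (case z of (x, y) \<Rightarrow> f x y) \<partial>map_pmf (\<lambda>(x, y). (y, x)) (pair_pmf q p))"
    by (subst pair_commute_pmf) simp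
  also have "\<dots> = (\<integral>\<^sup>+y. \<integral>\<^sup>+x. f x y \<partial>measure_pmf p \<partial>measure_pmf q)"
    by (simp add: nn_integral_pair_pmf' case_prod_beta)
  finally show ?thesis .
qed

text \<open>One unit cell: \<open>i\<close> and \<open>x\<close> are the increments of the passage
  time on its south and west sides, \<open>w\<close> is its weight. The first two components of the
  image are the increments on the north and east sides; the third, \<open>min i x\<close>, makes the
  map an involution.\<close>

fun burke :: "nat \<times> nat \<times> nat \<Rightarrow> nat \<times> nat \<times> nat" where
  "burke (i, x, w) = (w + (i - x), w + (x - i), min i x)"

lemma burke_burke: "burke (burke z) = z"
  by (cases z) (auto simp: min_def)

text \<open>Since \<open>r = b * (r / b)\<close>, the mass at \<open>(i, x, w)\<close> is
  proportional to \<open>b ^ (i + w) * (r / b) ^ (x + w)\<close>, and \<open>burke\<close> preserves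
  both \<open>i + w\<close> and \<open>x + w\<close>.\<close>

lemma burke_pmf:
  assumes "0 < r" "r < b" "b < 1"
  shows "map_pmf burke (pair_pmf (Geom b) (pair_pmf (Geom (r / b)) (Geom r))) =
         pair_pmf (Geom b) (pair_pmf (Geom (r / b)) (Geom r))" (is "map_pmf burke ?P = ?P")
proof (rule pmf_eqI)
  fix z :: "nat \<times> nat \<times> nat"
  have inj: "inj burke" by (metis burke_burke injI)
  obtain i x w where z: "z = (i, x, w)" by (cases z) auto
  have geo: "0 \<le> b" "b < 1" "0 \<le> r / b" "r / b < 1" "0 \<le> r" "r < 1"
    using assms by auto
  have rb: "r ^ k = b ^ k * (r / b) ^ k" for k
    using assms by (simp add: power_mult_distrib[symmetric])
  have "pmf (map_pmf burke ?P) z = pmf (map_pmf burke ?P) (burke (burke z))"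
    by (simp only: burke_burke)
  also have "\<dots> = pmf ?P (burke z)"
    by (rule pmf_map_inj'[OF inj])
  also have "\<dots> = pmf ?P z"
  proof (cases "i \<le> x")
    case True
    then obtain d where "x = i + d" by (metis le_Suc_ex)
    then show ?thesis
      by (simp add: z pmf_pair pmf_Geom[OF geo(1,2)] pmf_Geom[OF geo(3,4)]
        pmf_Geom[OF geo(5,6)] power_add rb mult_ac)
  next
    case False
    then obtain d where "i = x + d" by (metis le_Suc_ex nat_le_linear)
    then show ?thesis
      by (simp add: z pmf_pair pmf_Geom[OF geo(1,2)] pmf_Geom[OF geo(3,4)]
        pmf_Geom[OF geo(5,6)] power_add rb min_def mult_ac)
  qed
  finally show "pmf (map_pmf burke ?P) z = pmf ?P z" .
qed

lemma nn_integral_burke: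
  assumes "0 < r" "r < b" "b < 1"
  shows "(\<integral>\<^sup>+i. \<integral>\<^sup>+x. \<integral>\<^sup>+w. f (w + (i - x)) (w + (x - i)) \<partial>Geom r \<partial>Geom (r / b) \<partial>Geom b) =
         (\<integral>\<^sup>+i. \<integral>\<^sup>+x. f i x \<partial>Geom (r / b) \<partial>Geom b)"
proof -
  let ?P = "pair_pmf (Geom b) (pair_pmf (Geom (r / b)) (Geom r))"
  have "(\<integral>\<^sup>+i. \<integral>\<^sup>+x. \<integral>\<^sup>+w. f (w + (i - x)) (w + (x - i)) \<partial>Geom r \<partial>Geom (r / b) \<partial>Geom b) =
      (\<integral>\<^sup>+z. f (fst z) (fst (snd z)) \<partial>map_pmf burke ?P)"
    by (simp add: nn_integral_pair_pmf')
  also have "\<dots> = (\<integral>\<^sup>+i. \<integral>\<^sup>+x. f i x \<partial>Geom (r / b) \<partial>Geom b)"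
    by (simp add: burke_pmf[OF assms] nn_integral_pair_pmf')
  finally show ?thesis .
qed

text \<open>
  \<open>js\<close> are the vertical increments of the passage times along a column, \<open>i\<close> the horizontal increment at
  height \<open>0\<close> and \<open>ws\<close> the weights of the next column; \<open>hstep\<close> gives the horizontal increment between the
  two columns at each height, \<open>vstep\<close> the vertical increments along the next column.
\<close>

primrec hstep :: "(nat \<Rightarrow> nat) \<Rightarrow> nat \<Rightarrow> (nat \<Rightarrow> nat) \<Rightarrow> nat \<Rightarrow> nat" where
  "hstep js i ws 0 = i"
| "hstep js i ws (Suc j) = ws (Suc j) + (hstep js i ws j - js (Suc j))"

definition vstep :: "(nat \<Rightarrow> nat) \<Rightarrow> nat \<Rightarrow> (nat \<Rightarrow> nat) \<Rightarrow> nat \<Rightarrow> nat \<Rightarrow> nat" where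
  "vstep js i ws n j = (if j \<in> {1..n} then ws j + (js j - hstep js i ws (j - 1)) else 0)"

lemma hstep_cong:
  "(\<And>j. j \<in> {1..n} \<Longrightarrow> js j = js' j \<and> ws j = ws' j) \<Longrightarrow> hstep js i ws n = hstep js' i ws' n"
  by (induction n) auto

lemma vstep_Suc:
  "vstep (js(Suc n := x)) i (ws(Suc n := w)) (Suc n) =
   (vstep js i ws n)(Suc n := w + (x - hstep js i ws n))"
proof
  fix j
  have "hstep (js(Suc n := x)) i (ws(Suc n := w)) k = hstep js i ws k" if "k \<le> n" for k
    using that by (intro hstep_cong) auto
  then show "vstep (js(Suc n := x)) i (ws(Suc n := w)) (Suc n) j =
      ((vstep js i ws n)(Suc n := w + (x - hstep js i ws n))) j"
    by (auto simp: vstep_def)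
qed

lemma hstep_Suc:
  "hstep (js(Suc n := x)) i (ws(Suc n := w)) (Suc n) = w + (hstep js i ws n - x)"
proof -
  have "hstep (js(Suc n := x)) i (ws(Suc n := w)) n = hstep js i ws n"
    by (intro hstep_cong) auto
  then show ?thesis by simp
qed

lemma nn_integral_Pi_pmf_insert:
  assumes "finite A" "x \<notin> A"
  shows "(\<integral>\<^sup>+g. f g \<partial>Pi_pmf (insert x A) d p) = (\<integral>\<^sup>+g. \<integral>\<^sup>+y. f (g(x := y)) \<partial>p x \<partial>Pi_pmf A d p)"
  by (subst Pi_pmf_insert[OF assms])
     (simp add: nn_integral_pair_pmf' case_prod_beta nn_integral_pmf_swap[of _ "Pi_pmf A d p"])

text \<open>The cells of the column are processed upwards. By induction the horizontal increment at
  height \<open>n\<close> has law \<open>Geom b\<close> and is independent of the new vertical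
  increments below it, so together with the fresh \<open>x\<close> and \<open>w\<close> of the next
  cell it is a valid input of \<open>nn_integral_burke\<close>.\<close>

lemma nn_integral_burke_column:
  assumes "0 < r" "r < b" "b < 1"
  shows "(\<integral>\<^sup>+js. \<integral>\<^sup>+i. \<integral>\<^sup>+ws. f (vstep js i ws n) (hstep js i ws n)
            \<partial>Pi_pmf {1..n} 0 (\<lambda>_. Geom r) \<partial>Geom b \<partial>Pi_pmf {1..n} 0 (\<lambda>_. Geom (r / b))) =
         (\<integral>\<^sup>+js. \<integral>\<^sup>+i. f js i \<partial>Geom b \<partial>Pi_pmf {1..n} 0 (\<lambda>_. Geom (r / b)))"
proof (induction n arbitrary: f)
  case 0
  have "vstep js i ws 0 = (\<lambda>_. 0)" for js i ws
    by (auto simp: vstep_def)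
  then show ?case by simp
next
  case (Suc n)
  have ins: "{1..Suc n} = insert (Suc n) {1..n}" by auto
  let ?J = "Pi_pmf {1..n} 0 (\<lambda>_. Geom (r / b))"
  let ?W = "Pi_pmf {1..n} 0 (\<lambda>_. Geom r)"
  \<comment> \<open>\<open>g\<close> integrates out the topmost cell, given the vertical increments
    below it and the horizontal increment \<open>h\<close> on its south side. The induction
    hypothesis is applied to \<open>g\<close> in place of \<open>f\<close>.\<close>
  define g where "g = (\<lambda>js h. \<integral>\<^sup>+x. \<integral>\<^sup>+w. f (js(Suc n := w + (x - h))) (w + (h - x)) \<partial>Geom r \<partial>Geom (r / b))"
  have "(\<integral>\<^sup>+js. \<integral>\<^sup>+i. \<integral>\<^sup>+ws. f (vstep js i ws (Suc n)) (hstep js i ws (Suc n))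
            \<partial>Pi_pmf {1..Suc n} 0 (\<lambda>_. Geom r) \<partial>Geom b \<partial>Pi_pmf {1..Suc n} 0 (\<lambda>_. Geom (r / b))) =
    (\<integral>\<^sup>+js. \<integral>\<^sup>+x. \<integral>\<^sup>+i. \<integral>\<^sup>+ws. \<integral>\<^sup>+w. f ((vstep js i ws n)(Suc n := w + (x - hstep js i ws n))) (w + (hstep js i ws n - x))
       \<partial>Geom r \<partial>?W \<partial>Geom b \<partial>Geom (r / b) \<partial>?J)"
    unfolding ins by (simp add: nn_integral_Pi_pmf_insert vstep_Suc hstep_Suc del: hstep.simps)
  also have "\<dots> = (\<integral>\<^sup>+js. \<integral>\<^sup>+i. \<integral>\<^sup>+ws. g (vstep js i ws n) (hstep js i ws n) \<partial>?W \<partial>Geom b \<partial>?J)"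
    unfolding g_def
    by (simp only: nn_integral_pmf_swap[of "Geom (r / b)" "Geom b"] nn_integral_pmf_swap[of "Geom (r / b)" ?W])
  also have "\<dots> = (\<integral>\<^sup>+js. \<integral>\<^sup>+i. g js i \<partial>Geom b \<partial>?J)"
    by (rule Suc.IH)
  also have "\<dots> = (\<integral>\<^sup>+js. \<integral>\<^sup>+i. \<integral>\<^sup>+x. f (js(Suc n := x)) i \<partial>Geom (r / b) \<partial>Geom b \<partial>?J)"
    unfolding g_def by (subst nn_integral_burke[OF assms]) simp
  also have "\<dots> = (\<integral>\<^sup>+js. \<integral>\<^sup>+i. f js i \<partial>Geom b \<partial>Pi_pmf {1..Suc n} 0 (\<lambda>_. Geom (r / b)))"
    unfolding ins by (simp add: nn_integral_Pi_pmf_insert nn_integral_pmf_swap[of _ "Geom b"])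
  finally show ?case .
qed

section \<open>Exponential moments and tilting of geometric weights\<close>

lemma nn_integral_Geom_power:
  assumes "0 \<le> q" "q < 1" "0 \<le> t" "t * q < 1"
  shows "(\<integral>\<^sup>+i. ennreal (t ^ i) \<partial>Geom q) = ennreal ((1 - q) / (1 - t * q))"
proof -
  have "(\<integral>\<^sup>+i. ennreal (t ^ i) \<partial>Geom q) = (\<Sum>i. ennreal ((1 - q) * (t * q) ^ i))"
    unfolding nn_integral_measure_pmf nn_integral_count_space_nat
    using assms by (simp add: pmf_Geom ennreal_mult[symmetric] power_mult_distrib mult_ac)
  also have "\<dots> = ennreal ((1 - q) * (1 / (1 - t * q)))"
  proof (rule suminf_ennreal_eq)
    show "0 \<le> (1 - q) * (t * q) ^ i" for i using assms by simp
    show "(\<lambda>i. (1 - q) * (t * q) ^ i) sums ((1 - q) * (1 / (1 - t * q)))"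
      using assms by (intro sums_mult geometric_sums) simp
  qed
  finally show ?thesis by simp
qed

text \<open>The density of \<open>Geom b\<close> with respect to \<open>Geom a\<close> is a constant
  times \<open>(b / a) ^ i\<close>. This brings the weights of the horizontal axis to the parameter
  at which Burke's property applies.\<close>

lemma nn_integral_Geom_tilt:
  assumes "0 < a" "a < 1" "0 < b" "b < 1"
  shows "(\<integral>\<^sup>+i. ennreal ((b / a) ^ i) * f i \<partial>Geom a) = ennreal ((1 - a) / (1 - b)) * (\<integral>\<^sup>+i. f i \<partial>Geom b)"
proof -
  have "ennreal (pmf (Geom a) i) * (ennreal ((b / a) ^ i) * f i) =
        ennreal ((1 - a) / (1 - b)) * (ennreal (pmf (Geom b) i) * f i)" for i
  proof -
    have "pmf (Geom a) i * (b / a) ^ i = (1 - a) / (1 - b) * pmf (Geom b) i"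
      using assms by (simp add: pmf_Geom power_divide)
    then have "ennreal (pmf (Geom a) i) * ennreal ((b / a) ^ i) =
        ennreal ((1 - a) / (1 - b)) * ennreal (pmf (Geom b) i)"
      using assms by (simp flip: ennreal_mult)
    then show ?thesis by (metis mult.assoc)
  qed
  then show ?thesis
    unfolding nn_integral_measure_pmf by (simp add: nn_integral_cmult)
qed
section \<open>The moment generating function of the passage time\<close>

text \<open>The recursive form of the maximum over paths from the origin, where no weight is
  collected; \<open>lpt_stat_eq_passage\<close> identifies it with the definition by paths.\<close>

fun passage :: "(nat \<times> nat \<Rightarrow> nat) \<Rightarrow> nat \<Rightarrow> nat \<Rightarrow> nat" where
  "passage X 0 0 = 0"
| "passage X (Suc i) 0 = passage X i 0 + X (Suc i, 0)"
| "passage X 0 (Suc j) = passage X 0 j + X (0, Suc j)"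
| "passage X (Suc i) (Suc j) = X (Suc i, Suc j) + max (passage X i (Suc j)) (passage X (Suc i) j)"

definition sites :: "nat \<Rightarrow> nat \<Rightarrow> (nat \<times> nat) set" where
  "sites m n = {0..m} \<times> {0..n} - {(0, 0)}"

definition site_law :: "real \<Rightarrow> real \<Rightarrow> real \<Rightarrow> nat \<times> nat \<Rightarrow> nat pmf" where
  "site_law r \<alpha> \<beta> v = (if snd v = 0 then Geom \<alpha> else if fst v = 0 then Geom \<beta> else Geom r)"

definition lpp_pmf :: "real \<Rightarrow> real \<Rightarrow> real \<Rightarrow> nat \<Rightarrow> nat \<Rightarrow> (nat \<times> nat \<Rightarrow> nat) pmf" where
  "lpp_pmf r \<alpha> \<beta> m n = Pi_pmf (sites m n) 0 (site_law r \<alpha> \<beta>)"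

lemma finite_sites [simp]: "finite (sites m n)"
  by (simp add: sites_def)

lemma passage_cong:
  "(\<And>v. v \<in> sites m n \<Longrightarrow> X v = Y v) \<Longrightarrow> passage X m n = passage Y m n"
proof (induction X m n rule: passage.induct)
  case (2 X i)
  have "passage X i 0 = passage Y i 0" by (rule 2) (auto simp: sites_def intro!: "2.prems")
  then show ?case using "2.prems"[of "(Suc i, 0)"] by (simp add: sites_def)
next
  case (3 X j)
  have "passage X 0 j = passage Y 0 j" by (rule 3) (auto simp: sites_def intro!: "3.prems")
  then show ?case using "3.prems"[of "(0, Suc j)"] by (simp add: sites_def)
next
  case (4 X i j)
  have "passage X i (Suc j) = passage Y i (Suc j)" by (rule 4(1)) (auto simp: sites_def intro!: "4.prems")
  moreover have "passage X (Suc i) j = passage Y (Suc i) j" by (rule 4(2)) (auto simp: sites_def intro!: "4.prems")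
  ultimately show ?case using "4.prems"[of "(Suc i, Suc j)"] by (simp add: sites_def)
qed simp

lemma passage_mono: "(\<And>v. X v \<le> Y v) \<Longrightarrow> passage X m n \<le> passage Y m n"
proof (induction X m n rule: passage.induct)
  case (4 X i j)
  have "X (Suc i, Suc j) \<le> Y (Suc i, Suc j)" "passage X i (Suc j) \<le> passage Y i (Suc j)"
    "passage X (Suc i) j \<le> passage Y (Suc i) j"
    using 4 by blast+
  then show ?case by (auto simp: max_def)
qed (auto intro: add_mono)

lemma passage_le_Suc1: "passage X i j \<le> passage X (Suc i) j"
  by (cases j) auto

lemma passage_le_Suc2: "passage X i j \<le> passage X i (Suc j)"
  by (cases i) auto

section \<open>Splitting and reindexing of product laws\<close>

lemma nn_integral_Pi_pmf_union:
  assumes "finite A" "finite B" "A \<inter> B = {}"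
  shows "(\<integral>\<^sup>+X. f X \<partial>Pi_pmf (A \<union> B) d p) =
         (\<integral>\<^sup>+X. \<integral>\<^sup>+Z. f (\<lambda>x. if x \<in> A then X x else Z x) \<partial>Pi_pmf B d p \<partial>Pi_pmf A d p)"
  by (simp only: Pi_pmf_union[OF assms] nn_integral_map_pmf nn_integral_pair_pmf' split_beta fst_conv snd_conv)

text \<open>The preimage of a point \<open>f\<close> is a box: a single value at each coordinate in
  the image of \<open>h\<close>, no restriction elsewhere. Its probability factorizes, and the
  unrestricted coordinates contribute factors 1.\<close>

lemma Pi_pmf_reindex:
  assumes B: "finite B" and A: "finite A" and h: "inj_on h A" "h ` A \<subseteq> B"
  shows "map_pmf (\<lambda>X x. if x \<in> A then X (h x) else d) (Pi_pmf B d p) = Pi_pmf A d (\<lambda>x. p (h x))"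
proof (rule pmf_eqI)
  fix f
  show "pmf (map_pmf (\<lambda>X x. if x \<in> A then X (h x) else d) (Pi_pmf B d p)) f = pmf (Pi_pmf A d (\<lambda>x. p (h x))) f"
  proof (cases "\<forall>x. x \<notin> A \<longrightarrow> f x = d")
    case True
    define S where "S = (\<lambda>y. if y \<in> h ` A then {f (inv_into A h y)} else UNIV)"
    have eq: "(\<lambda>X x. if x \<in> A then X (h x) else d) -` {f} = Pi B S"
    proof (intro set_eqI)
      fix X
      have "X \<in> (\<lambda>X x. if x \<in> A then X (h x) else d) -` {f} \<longleftrightarrow> (\<forall>x\<in>A. X (h x) = f x)"
        using True by (auto simp: fun_eq_iff)
      also have "\<dots> \<longleftrightarrow> X \<in> Pi B S"
        using h by (auto simp: S_def Pi_def)
      finally show "X \<in> (\<lambda>X x. if x \<in> A then X (h x) else d) -` {f} \<longleftrightarrow> X \<in> Pi B S" .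
    qed
    have "pmf (map_pmf (\<lambda>X x. if x \<in> A then X (h x) else d) (Pi_pmf B d p)) f =
        (\<Prod>y\<in>B. measure_pmf.prob (p y) (S y))"
      unfolding pmf_map eq by (rule measure_Pi_pmf_Pi[OF B])
    also have "\<dots> = (\<Prod>y\<in>h ` A. measure_pmf.prob (p y) (S y))"
      using B h by (intro prod.mono_neutral_right) (auto simp: S_def)
    also have "\<dots> = (\<Prod>x\<in>A. measure_pmf.prob (p (h x)) (S (h x)))"
      using h by (simp add: prod.reindex)
    also have "\<dots> = (\<Prod>x\<in>A. pmf (p (h x)) (f x))"
      using h by (intro prod.cong) (auto simp: S_def measure_pmf_single)
    finally show ?thesis using True A by (simp add: pmf_Pi)
  next
    case False
    then have eq: "(\<lambda>X x. if x \<in> A then X (h x) else d) -` {f} = {}"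
      by (auto simp: fun_eq_iff)
    show ?thesis using False A unfolding pmf_map eq by (simp add: pmf_Pi_outside)
  qed
qed

text \<open>The value 0 outside \<open>{1..n}\<close> is the default value of the product law with
  which these increments are compared. The subtraction does not truncate, by
  \<open>passage_le_Suc2\<close>.\<close>

definition vincr :: "(nat \<times> nat \<Rightarrow> nat) \<Rightarrow> nat \<Rightarrow> nat \<Rightarrow> nat \<Rightarrow> nat" where
  "vincr X m n j = (if j \<in> {1..n} then passage X m j - passage X m (j - 1) else 0)"

lemma vincr_cong:
  assumes "\<And>v. v \<in> sites m n \<Longrightarrow> X v = Y v"
  shows "vincr X m n = vincr Y m n"
proof
  fix j
  have "passage X m j' = passage Y m j'" if "j' \<le> n" for j'
    using that by (intro passage_cong assms) (auto simp: sites_def)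
  then show "vincr X m n j = vincr Y m n j"
    by (auto simp: vincr_def)
qed

text \<open>Subtracting \<open>passage X m (Suc j)\<close> from the recursion for
  \<open>passage X (Suc m) (Suc j)\<close> turns the maximum into a positive part, which on
  \<open>nat\<close> is the truncated difference in \<open>hstep\<close>; the same holds for
  vertical increments and \<open>vstep\<close>.\<close>

lemma vincr_Suc:
  "vincr X (Suc m) n = vstep (vincr X m n) (X (Suc m, 0)) (\<lambda>j. if j \<in> {1..n} then X (Suc m, j) else 0) n"
proof -
  let ?ws = "\<lambda>j. if j \<in> {1..n} then X (Suc m, j) else 0"
  have h: "hstep (vincr X m n) (X (Suc m, 0)) ?ws j = passage X (Suc m) j - passage X m j" if "j \<le> n" for j
    using that
  proof (induction j)
    case (Suc j)
    have "vincr X m n (Suc j) = passage X m (Suc j) - passage X m j"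
      using Suc.prems by (simp add: vincr_def)
    then show ?case
      using Suc passage_le_Suc1[of X m j] passage_le_Suc2[of X m j] by (auto simp: max_def)
  qed simp
  show ?thesis
  proof
    fix j
    show "vincr X (Suc m) n j = vstep (vincr X m n) (X (Suc m, 0)) ?ws n j"
    proof (cases "j \<in> {1..n}")
      case True
      then obtain k where k: "j = Suc k" "k < n" by (cases j) auto
      show ?thesis
        using k h[of k] passage_le_Suc1[of X m k] passage_le_Suc2[of X m k]
        by (auto simp: vstep_def vincr_def max_def)
    qed (auto simp: vincr_def vstep_def)
  qed
qed

lemma passage_eq_sum_vincr: "passage X m n = passage X m 0 + (\<Sum>j\<in>{1..n}. vincr X m n j)"
proof -
  have "k \<le> n \<Longrightarrow> passage X m k = passage X m 0 + (\<Sum>j\<in>{1..k}. vincr X m n j)" for k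
  proof (induction k)
    case (Suc k)
    have "passage X m (Suc k) = passage X m k + vincr X m n (Suc k)"
      using Suc.prems passage_le_Suc2[of X m k] by (simp add: vincr_def)
    also have "\<dots> = passage X m 0 + (\<Sum>j\<in>{1..Suc k}. vincr X m n j)"
      using Suc by simp
    finally show ?case .
  qed simp
  from this[of n] show ?thesis by simp
qed

text \<open>The factor \<open>b / a\<close> per unit of boundary weight turns the horizontal axis
  into one with parameter \<open>b\<close>, at the price \<open>(1 - a) / (1 - b)\<close> per site.
  With both axes at \<open>b\<close> the vertical increments along every column have the stationary
  law. The function \<open>f\<close> is arbitrary so that the induction on \<open>m\<close> can
  absorb the last column into it.\<close>

lemma nn_integral_lpp_pmf_tilt:
  assumes r: "0 < r" and a: "r < a" "a < 1" and b: "r < b" "b < 1"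
  shows "(\<integral>\<^sup>+X. ennreal ((b / a) ^ passage X m 0) * f (vincr X m n) \<partial>lpp_pmf r a (r / b) m n) =
         ennreal (((1 - a) / (1 - b)) ^ m) * (\<integral>\<^sup>+js. f js \<partial>Pi_pmf {1..n} 0 (\<lambda>_. Geom (r / b)))"
proof (induction m arbitrary: f)
  case 0
  have j: "vincr X 0 n = (\<lambda>j. if j \<in> {1..n} then X (0, j) else 0)" for X
  proof
    show "vincr X 0 n j = (if j \<in> {1..n} then X (0, j) else 0)" for j
      by (cases j) (auto simp: vincr_def)
  qed
  have "(\<integral>\<^sup>+X. f (vincr X 0 n) \<partial>lpp_pmf r a (r / b) 0 n) =
      (\<integral>\<^sup>+js. f js \<partial>map_pmf (\<lambda>X j. if j \<in> {1..n} then X (0, j) else 0) (lpp_pmf r a (r / b) 0 n))"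
    by (simp add: j)
  also have "map_pmf (\<lambda>X j. if j \<in> {1..n} then X (0, j) else 0) (lpp_pmf r a (r / b) 0 n) =
      Pi_pmf {1..n} 0 (\<lambda>j. site_law r a (r / b) (0, j))"
    unfolding lpp_pmf_def by (intro Pi_pmf_reindex) (auto simp: inj_on_def sites_def)
  also have "\<dots> = Pi_pmf {1..n} 0 (\<lambda>_. Geom (r / b))"
    by (intro Pi_pmf_cong) (auto simp: site_law_def)
  finally show ?case by simp
next
  case (Suc m)
  let ?s = "site_law r a (r / b)"
  let ?W = "Pi_pmf {1..n} 0 (\<lambda>_. Geom r)"
  let ?J = "Pi_pmf {1..n} 0 (\<lambda>_. Geom (r / b))"
  define C where "C = {Suc m} \<times> {1..n}"
  have sites: "sites (Suc m) n = sites m n \<union> insert (Suc m, 0) C"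
    by (auto simp: sites_def C_def)
  have disj: "sites m n \<inter> insert (Suc m, 0) C = {}" and fin: "finite C" and nin: "(Suc m, 0) \<notin> C"
    by (auto simp: sites_def C_def)
  \<comment> \<open>The integrand in terms of the first \<open>m\<close> columns \<open>X\<close>,
    the new axis weight \<open>i\<close> and the bulk weights \<open>ws\<close> of the new
    column.\<close>
  define F where "F = (\<lambda>X i ws. ennreal ((b / a) ^ (passage X m 0 + i)) * f (vstep (vincr X m n) i ws n))"
  have F: "ennreal ((b / a) ^ passage X (Suc m) 0) * f (vincr X (Suc m) n) =
      F Y i (\<lambda>j. if j \<in> {1..n} then Z (Suc m, j) else 0)"
    if "X = (\<lambda>x. if x \<in> sites m n then Y x else (Z((Suc m, 0) := i)) x)" for X Y Z i
  proof -
    have 1: "X v = Y v" if "v \<in> sites m n" for v using that \<open>X = _\<close> by simp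
    have "passage X m 0 = passage Y m 0" by (intro passage_cong 1) (auto simp: sites_def)
    moreover have "vincr X m n = vincr Y m n" by (intro vincr_cong 1)
    moreover have "X (Suc m, 0) = i" using that by (simp add: sites_def)
    moreover have "(\<lambda>j. if j \<in> {1..n} then X (Suc m, j) else 0) = (\<lambda>j. if j \<in> {1..n} then Z (Suc m, j) else 0)"
      using that by (auto simp: sites_def fun_eq_iff)
    ultimately show ?thesis by (simp add: F_def vincr_Suc)
  qed
  have W: "map_pmf (\<lambda>Z j. if j \<in> {1..n} then Z (Suc m, j) else 0) (Pi_pmf C 0 ?s) = ?W"
  proof -
    have "map_pmf (\<lambda>Z j. if j \<in> {1..n} then Z (Suc m, j) else 0) (Pi_pmf C 0 ?s) =
        Pi_pmf {1..n} 0 (\<lambda>j. ?s (Suc m, j))"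
      by (intro Pi_pmf_reindex fin) (auto simp: inj_on_def C_def)
    also have "\<dots> = ?W" by (intro Pi_pmf_cong) (auto simp: site_law_def)
    finally show ?thesis .
  qed
  have s0: "?s (Suc m, 0) = Geom a" by (simp add: site_law_def)
  \<comment> \<open>What remains of the new column once its axis weight has been tilted from
    \<open>a\<close> to \<open>b\<close>.\<close>
  define g where "g = (\<lambda>js. ennreal ((1 - a) / (1 - b)) * (\<integral>\<^sup>+i. \<integral>\<^sup>+ws. f (vstep js i ws n) \<partial>?W \<partial>Geom b))"
  have "(\<integral>\<^sup>+X. ennreal ((b / a) ^ passage X (Suc m) 0) * f (vincr X (Suc m) n) \<partial>lpp_pmf r a (r / b) (Suc m) n) =
      (\<integral>\<^sup>+Y. \<integral>\<^sup>+Z. \<integral>\<^sup>+i. F Y i (\<lambda>j. if j \<in> {1..n} then Z (Suc m, j) else 0) \<partial>Geom a \<partial>Pi_pmf C 0 ?s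
        \<partial>lpp_pmf r a (r / b) m n)"
    unfolding lpp_pmf_def sites
    by (simp only: nn_integral_Pi_pmf_union[OF finite_sites finite.insertI[OF fin] disj]
        nn_integral_Pi_pmf_insert[OF fin nin] F[OF refl] s0)
  also have "\<dots> = (\<integral>\<^sup>+Y. \<integral>\<^sup>+i. \<integral>\<^sup>+ws. F Y i ws \<partial>?W \<partial>Geom a \<partial>lpp_pmf r a (r / b) m n)"
    by (simp only: W[symmetric] nn_integral_map_pmf nn_integral_pmf_swap[of "Pi_pmf C 0 ?s" "Geom a"])
  also have "\<dots> = (\<integral>\<^sup>+Y. ennreal ((b / a) ^ passage Y m 0) * g (vincr Y m n) \<partial>lpp_pmf r a (r / b) m n)"
  proof (intro nn_integral_cong)
    fix Y
    have "(\<integral>\<^sup>+i. \<integral>\<^sup>+ws. F Y i ws \<partial>?W \<partial>Geom a) =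
        (\<integral>\<^sup>+i. ennreal ((b / a) ^ passage Y m 0) * (ennreal ((b / a) ^ i) * (\<integral>\<^sup>+ws. f (vstep (vincr Y m n) i ws n) \<partial>?W)) \<partial>Geom a)"
      using r a b by (simp add: F_def power_add ennreal_mult nn_integral_cmult mult.assoc)
    also have "\<dots> = ennreal ((b / a) ^ passage Y m 0) * g (vincr Y m n)"
      unfolding g_def using r a b by (simp add: nn_integral_cmult nn_integral_Geom_tilt)
    finally show "(\<integral>\<^sup>+i. \<integral>\<^sup>+ws. F Y i ws \<partial>?W \<partial>Geom a) = ennreal ((b / a) ^ passage Y m 0) * g (vincr Y m n)" .
  qed
  also have "\<dots> = ennreal (((1 - a) / (1 - b)) ^ m) * (\<integral>\<^sup>+js. g js \<partial>?J)"
    by (rule Suc.IH)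
  also have "(\<integral>\<^sup>+js. g js \<partial>?J) = ennreal ((1 - a) / (1 - b)) * (\<integral>\<^sup>+js. f js \<partial>?J)"
    unfolding g_def using nn_integral_burke_column[OF r b, of n "\<lambda>js h. f js"] by (simp add: nn_integral_cmult)
  moreover have "ennreal (((1 - a) / (1 - b)) ^ Suc m) =
      ennreal (((1 - a) / (1 - b)) ^ m) * ennreal ((1 - a) / (1 - b))"
    using a b by (subst ennreal_mult[symmetric]) (simp_all add: mult.commute)
  ultimately show ?case
    by (simp only: mult.assoc)
qed

lemma nn_integral_Pi_pmf_power_sum:
  assumes A: "finite A" and "0 \<le> q" "q < 1" "0 \<le> t" "t * q < 1"
  shows "(\<integral>\<^sup>+X. ennreal (t ^ (\<Sum>x\<in>A. X x)) \<partial>Pi_pmf A 0 (\<lambda>_. Geom q)) = ennreal (((1 - q) / (1 - t * q)) ^ card A)"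
proof -
  have "(\<integral>\<^sup>+X. ennreal (t ^ (\<Sum>x\<in>A. X x)) \<partial>Pi_pmf A 0 (\<lambda>_. Geom q)) =
      (\<integral>\<^sup>+X. (\<Prod>x\<in>A. ennreal (t ^ X x)) \<partial>Pi_pmf A 0 (\<lambda>_. Geom q))"
    using assms by (simp add: power_sum prod_ennreal)
  also have "\<dots> = ennreal (((1 - q) / (1 - t * q)) ^ card A)"
    using assms by (subst nn_integral_prod_Pi_pmf[OF A]) (simp add: nn_integral_Geom_power ennreal_power)
  finally show ?thesis .
qed

text \<open>The passage time is the sum of the axis part and the \<open>n\<close> vertical
  increments along column \<open>m\<close>. After the tilt these increments are independent with law
  \<open>Geom (r / b)\<close>, and each contributes a geometric moment at
  \<open>b / a\<close>.\<close>

lemma nn_integral_lpp_pmf_power_passage: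
  assumes r: "0 < r" and a: "r < a" "a < 1" and b: "r < b" "b < 1"
  shows "(\<integral>\<^sup>+X. ennreal ((b / a) ^ passage X m n) \<partial>lpp_pmf r a (r / b) m n) =
         ennreal (((1 - a) / (1 - b)) ^ m * ((1 - r / b) / (1 - r / a)) ^ n)"
proof -
  have "(\<integral>\<^sup>+X. ennreal ((b / a) ^ passage X m n) \<partial>lpp_pmf r a (r / b) m n) =
      (\<integral>\<^sup>+X. ennreal ((b / a) ^ passage X m 0) * ennreal ((b / a) ^ (\<Sum>j\<in>{1..n}. vincr X m n j)) \<partial>lpp_pmf r a (r / b) m n)"
    using r a b by (subst passage_eq_sum_vincr) (simp add: power_add ennreal_mult)
  also have "\<dots> = ennreal (((1 - a) / (1 - b)) ^ m) * ennreal (((1 - r / b) / (1 - b / a * (r / b))) ^ n)"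
    using r a b by (subst nn_integral_lpp_pmf_tilt[where f = "\<lambda>js. ennreal ((b / a) ^ (\<Sum>j\<in>{1..n}. js j))"])
      (auto simp: nn_integral_Pi_pmf_power_sum)
  also have "b / a * (r / b) = r / a" using r b by simp
  finally show ?thesis using r a b by (simp add: ennreal_mult)
qed
section \<open>Exit points and changes of measure\<close>

text \<open>Passage times of \<open>cut l X\<close> do not see the axis beyond
  \<open>(l, 0)\<close>, so they can be compared between two boundary parameters at a cost that
  grows with \<open>l\<close> and not with \<open>m\<close>.\<close>

definition cut :: "nat \<Rightarrow> (nat \<times> nat \<Rightarrow> nat) \<Rightarrow> nat \<times> nat \<Rightarrow> nat" where
  "cut l X v = (if snd v = 0 \<and> l < fst v then 0 else X v)"

text \<open>The model restarted at \<open>(l, 0)\<close>. Its own vertical axis, the column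
  \<open>l\<close>, is set to 0, so only paths that continue to the right along the horizontal axis
  profit from the boundary.\<close>

definition shift :: "nat \<Rightarrow> (nat \<times> nat \<Rightarrow> nat) \<Rightarrow> nat \<times> nat \<Rightarrow> nat" where
  "shift l X v = (if fst v = 0 then 0 else X (l + fst v, snd v))"

text \<open>For \<open>l < m\<close> this says that some maximal path leaves the horizontal axis after \<open>(l, 0)\<close>.\<close>

definition exits_after :: "(nat \<times> nat \<Rightarrow> nat) \<Rightarrow> nat \<Rightarrow> nat \<Rightarrow> nat \<Rightarrow> bool" where
  "exits_after X m n l \<longleftrightarrow> l < m \<and> passage X m n \<le> passage X l 0 + passage (shift l X) (m - l) n"

lemma passage_cut_le: "passage (cut l X) m n \<le> passage X m n"
  by (rule passage_mono) (simp add: cut_def)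

lemma passage_cut_eq: "m \<le> l \<Longrightarrow> passage (cut l X) m n = passage X m n"
  by (rule passage_cong) (auto simp: cut_def sites_def)

lemma passage_add_0: "passage X (l + d) 0 = passage X l 0 + passage (shift l X) d 0"
  by (induction d) (simp_all add: shift_def)

text \<open>Both alternatives satisfy the recursion of \<open>passage\<close> with the same bulk
  weights, so the bound propagates site by site. In terms of paths: either the axis is left at or
  before \<open>(l, 0)\<close> and the erased weights are missed, or the path continues along the
  axis beyond \<open>(l, 0)\<close>.\<close>

lemma passage_le_max_cut_shift:
  "passage X (l + d) n \<le> max (passage (cut l X) (l + d) n) (passage X l 0 + passage (shift l X) d n)"
proof (induction d arbitrary: n)
  case 0
  then show ?case by (simp add: passage_cut_eq)
next
  case (Suc d)
  show ?case
  proof (induction n)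
    case 0
    show ?case using passage_add_0[of X l "Suc d"] by simp
  next
    case (Suc n)
    have "shift l X (Suc d, Suc n) = X (Suc (l + d), Suc n)"
      "cut l X (Suc (l + d), Suc n) = X (Suc (l + d), Suc n)"
      by (simp_all add: shift_def cut_def)
    then show ?case
      using Suc.IH \<open>\<And>n. passage X (l + d) n \<le> _\<close>[of "Suc n"] by (auto simp: max_def split: if_splits)
  qed
qed

text \<open>This reduces the lower tail of the cut passage time to that of the full one, up to the
  event that the exit point is larger than \<open>l\<close>.\<close>

lemma passage_cut_or_exits_after:
  "passage X m n = passage (cut l X) m n \<or> exits_after X m n l"
proof (cases "m \<le> l")
  case False
  then show ?thesis
    using passage_le_max_cut_shift[of X l "m - l" n] passage_cut_le[of l X m n]
    by (auto simp: exits_after_def max_def split: if_splits)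
qed (simp add: passage_cut_eq)

lemma passage_0_eq_sum: "passage X l 0 = (\<Sum>i\<in>{1..l}. X (i, 0))"
  by (induction l) simp_all

text \<open>Markov's inequality. The hypothesis on \<open>E\<close> covers bases \<open>t\<close>
  above 1 (upper tails) as well as below 1 (lower tails).\<close>

lemma prob_le_exp_moment:
  assumes "(\<integral>\<^sup>+X. ennreal (t ^ f X) \<partial>measure_pmf P) \<le> ennreal B"
    and "0 \<le> w" "0 \<le> t" "0 \<le> B" and "\<And>X. X \<in> E \<Longrightarrow> 1 \<le> w * t ^ f X"
  shows "measure_pmf.prob P E \<le> w * B"
proof -
  have "ennreal (measure_pmf.prob P E) = (\<integral>\<^sup>+X. indicator E X \<partial>measure_pmf P)"
    by (simp add: measure_pmf.emeasure_eq_measure)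
  also have "\<dots> \<le> (\<integral>\<^sup>+X. ennreal w * ennreal (t ^ f X) \<partial>measure_pmf P)"
  proof (intro nn_integral_mono)
    fix X
    show "indicator E X \<le> ennreal w * ennreal (t ^ f X)"
      using assms(2,3) assms(5)[of X] by (cases "X \<in> E") (simp_all flip: ennreal_mult)
  qed
  also have "\<dots> = ennreal w * (\<integral>\<^sup>+X. ennreal (t ^ f X) \<partial>measure_pmf P)"
    by (rule nn_integral_cmult) simp
  also have "\<dots> \<le> ennreal w * ennreal B"
    by (intro mult_left_mono assms) simp
  finally show ?thesis using assms by (simp flip: ennreal_mult)
qed

text \<open>Split \<open>E\<close> according to whether the density \<open>\<rho>\<close> is below \<open>K\<close>.\<close>

lemma prob_le_change_of_measure:
  fixes P P' :: "'b pmf"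
  assumes \<rho>: "\<And>X. pmf P X = \<rho> X * pmf P' X" "\<And>X. 0 \<le> \<rho> X"
    and B: "(\<integral>\<^sup>+X. ennreal (\<rho> X) \<partial>measure_pmf P) \<le> ennreal B" "0 \<le> B" and K: "0 < K"
  shows "measure_pmf.prob P E \<le> K * measure_pmf.prob P' E + B / K"
proof -
  have "ennreal (measure_pmf.prob P E) = (\<integral>\<^sup>+X. indicator E X \<partial>measure_pmf P)"
    by (simp add: measure_pmf.emeasure_eq_measure)
  also have "\<dots> = (\<integral>\<^sup>+X. ennreal (pmf P X) * indicator E X \<partial>count_space UNIV)"
    by (rule nn_integral_measure_pmf)
  also have "\<dots> \<le> (\<integral>\<^sup>+X. ennreal K * (ennreal (pmf P' X) * indicator E X) +
      ennreal (1 / K) * (ennreal (pmf P X) * ennreal (\<rho> X)) \<partial>count_space UNIV)"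
  proof (intro nn_integral_mono)
    fix X
    show "ennreal (pmf P X) * indicator E X \<le> ennreal K * (ennreal (pmf P' X) * indicator E X) +
      ennreal (1 / K) * (ennreal (pmf P X) * ennreal (\<rho> X))"
    proof (cases "X \<in> E")
      case True
      have "pmf P X \<le> K * pmf P' X + 1 / K * (pmf P X * \<rho> X)"
      proof (cases "\<rho> X \<le> K")
        case True
        then have "pmf P X \<le> K * pmf P' X" unfolding \<rho>(1) by (intro mult_right_mono) auto
        moreover have "0 \<le> 1 / K * (pmf P X * \<rho> X)" using K \<rho>(2)[of X] by simp
        ultimately show ?thesis by linarith
      next
        case False
        then have "pmf P X * K \<le> pmf P X * \<rho> X" by (intro mult_left_mono) auto
        then have "pmf P X \<le> 1 / K * (pmf P X * \<rho> X)" using K by (simp add: field_simps)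
        moreover have "0 \<le> K * pmf P' X" using K by simp
        ultimately show ?thesis by linarith
      qed
      then show ?thesis
        using True K \<rho>(2)[of X] by (simp flip: ennreal_mult ennreal_plus)
    qed simp
  qed
  also have "\<dots> = ennreal K * (\<integral>\<^sup>+X. indicator E X \<partial>measure_pmf P') +
      ennreal (1 / K) * (\<integral>\<^sup>+X. ennreal (\<rho> X) \<partial>measure_pmf P)"
    by (simp add: nn_integral_add nn_integral_cmult nn_integral_measure_pmf
        del: nn_integral_indicator)
  also have "\<dots> \<le> ennreal K * ennreal (measure_pmf.prob P' E) + ennreal (1 / K) * ennreal B"
    by (intro add_mono mult_left_mono B) (simp_all add: measure_pmf.emeasure_eq_measure)
  also have "\<dots> = ennreal (K * measure_pmf.prob P' E + B / K)"
    using K B by (simp flip: ennreal_mult ennreal_plus)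
  finally have le: "ennreal (measure_pmf.prob P E) \<le> ennreal (K * measure_pmf.prob P' E + B / K)" .
  have nonneg: "0 \<le> K * measure_pmf.prob P' E + B / K" using K B by simp
  from le show ?thesis by (simp only: ennreal_le_iff[OF nonneg])
qed

lemma nn_integral_passage_0:
  assumes "l \<le> m" "0 \<le> a" "a < 1" "0 \<le> t" "t * a < 1"
  shows "(\<integral>\<^sup>+X. ennreal (t ^ passage X l 0) \<partial>lpp_pmf r a \<beta> m n) = ennreal (((1 - a) / (1 - t * a)) ^ l)"
proof -
  have "(\<integral>\<^sup>+X. ennreal (t ^ passage X l 0) \<partial>lpp_pmf r a \<beta> m n) =
    (\<integral>\<^sup>+Y. ennreal (t ^ (\<Sum>i\<in>{1..l}. Y i)) \<partial>map_pmf (\<lambda>X i. if i \<in> {1..l} then X (i, 0) else 0) (lpp_pmf r a \<beta> m n))"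
    by (simp add: passage_0_eq_sum)
  also have "map_pmf (\<lambda>X i. if i \<in> {1..l} then X (i, 0) else 0) (lpp_pmf r a \<beta> m n) =
      Pi_pmf {1..l} 0 (\<lambda>i. site_law r a \<beta> (i, 0))"
    unfolding lpp_pmf_def using assms(1) by (intro Pi_pmf_reindex) (auto simp: inj_on_def sites_def)
  also have "\<dots> = Pi_pmf {1..l} 0 (\<lambda>_. Geom a)"
    by (intro Pi_pmf_cong) (auto simp: site_law_def)
  finally show ?thesis using assms by (simp add: nn_integral_Pi_pmf_power_sum)
qed

text \<open>The shifted model ignores the weights on the vertical axis, so \<open>\<beta>\<close> may be replaced
  by the value \<open>r / b\<close> for which the moment generating function is explicit.\<close>

lemma nn_integral_passage_shift:
  assumes r: "0 < r" and a: "r < a" "a \<le> b" "b < 1" and l: "l \<le> m"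
  shows "(\<integral>\<^sup>+X. ennreal ((b / a) ^ passage (shift l X) (m - l) n) \<partial>lpp_pmf r a \<beta> m n) \<le>
         ennreal (((1 - a) / (1 - b)) ^ (m - l) * ((1 - r / b) / (1 - r / a)) ^ n)"
proof -
  define A where "A = {1..m - l} \<times> {0..n}"
  define q where "q = (\<lambda>X v. if v \<in> A then X v else (0::nat))"
  have "map_pmf (\<lambda>X v. if v \<in> A then X (l + fst v, snd v) else 0) (lpp_pmf r a \<beta> m n) =
      Pi_pmf A 0 (\<lambda>v. site_law r a \<beta> (l + fst v, snd v))"
    unfolding lpp_pmf_def using l by (intro Pi_pmf_reindex) (auto simp: inj_on_def sites_def A_def)
  also have "\<dots> = Pi_pmf A 0 (\<lambda>v. site_law r a (r / b) v)"
    by (intro Pi_pmf_cong) (auto simp: site_law_def A_def)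
  also have "\<dots> = map_pmf q (lpp_pmf r a (r / b) (m - l) n)"
    unfolding lpp_pmf_def q_def by (rule Pi_pmf_subset) (auto simp: A_def sites_def)
  finally have eq: "map_pmf (\<lambda>X v. if v \<in> A then X (l + fst v, snd v) else 0) (lpp_pmf r a \<beta> m n) =
      map_pmf q (lpp_pmf r a (r / b) (m - l) n)" .
  have "passage (shift l X) (m - l) n = passage (\<lambda>v. if v \<in> A then X (l + fst v, snd v) else 0) (m - l) n" for X
    by (rule passage_cong) (auto simp: shift_def sites_def A_def)
  then have "(\<integral>\<^sup>+X. ennreal ((b / a) ^ passage (shift l X) (m - l) n) \<partial>lpp_pmf r a \<beta> m n) =
      (\<integral>\<^sup>+Y. ennreal ((b / a) ^ passage Y (m - l) n)
        \<partial>map_pmf (\<lambda>X v. if v \<in> A then X (l + fst v, snd v) else 0) (lpp_pmf r a \<beta> m n))"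
    by simp
  also have "\<dots> = (\<integral>\<^sup>+X. ennreal ((b / a) ^ passage (q X) (m - l) n) \<partial>lpp_pmf r a (r / b) (m - l) n)"
    unfolding eq by simp
  \<comment> \<open>Putting back the weights on the vertical axis can only increase the passage
    time, and \<open>b / a\<close> is at least 1.\<close>
  also have "\<dots> \<le> (\<integral>\<^sup>+X. ennreal ((b / a) ^ passage X (m - l) n) \<partial>lpp_pmf r a (r / b) (m - l) n)"
  proof (intro nn_integral_mono ennreal_leI power_increasing)
    show "passage (q X) (m - l) n \<le> passage X (m - l) n" for X
      by (rule passage_mono) (simp add: q_def)
  qed (use r a in simp)
  also have "\<dots> = ennreal (((1 - a) / (1 - b)) ^ (m - l) * ((1 - r / b) / (1 - r / a)) ^ n)"
    using r a by (intro nn_integral_lpp_pmf_power_passage) auto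
  finally show ?thesis .
qed

text \<open>Only the first \<open>l\<close> sites of the horizontal axis change their law. At such a
  site the mean under \<open>Geom a\<close> of the density of \<open>Geom a\<close> with respect to
  \<open>Geom a'\<close> is the quotient bounded by \<open>B\<close>; the condition
  \<open>a ^ 2 < a'\<close> makes it finite.\<close>

lemma prob_passage_cut_le:
  assumes a: "0 < a" "a < 1" "0 < a'" "a' < 1" "a ^ 2 < a'" and K: "0 < K"
    and B: "1 \<le> B" "(1 - a) ^ 2 / ((1 - a') * (1 - a ^ 2 / a')) \<le> B"
  shows "measure_pmf.prob (lpp_pmf r a \<beta> m n) {X. Q (passage (cut l X) m n)} \<le>
    K * measure_pmf.prob (lpp_pmf r a' \<beta> m n) {X. Q (passage (cut l X) m n)} + B ^ l / K"
proof -
  define A where "A = {v \<in> sites m n. \<not> (snd v = 0 \<and> l < fst v)}"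
  define L where "L = {v \<in> sites m n. snd v = 0 \<and> fst v \<le> l}"
  \<comment> \<open>An intermediate law: it differs from the first model only on \<open>L\<close>,
    where the density lives, and agrees with the second model on \<open>A\<close>, the sites that
    determine the event.\<close>
  define D where "D = (\<lambda>v. if v \<in> L then Geom a' else site_law r a \<beta> v)"
  define R where "R = (\<lambda>X v. if v \<in> A then X v else (0::nat))"
  define E where "E = {X. Q (passage (cut l X) m n)}"
  have AL: "A \<subseteq> sites m n" "L \<subseteq> sites m n" "finite L"
    by (auto simp: A_def L_def)
  have passage_R: "passage (cut l (R X)) m n = passage (cut l X) m n" for X
    by (rule passage_cong) (auto simp: R_def A_def cut_def)
  have E_R: "R -` E = E" by (auto simp: E_def passage_R)
  define \<rho> where "\<rho> = (\<lambda>X. \<Prod>v\<in>L. (a / a') ^ X v * ((1 - a) / (1 - a')))"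
  have "measure_pmf.prob (lpp_pmf r a \<beta> m n) E \<le>
      K * measure_pmf.prob (Pi_pmf (sites m n) 0 D) E + B ^ l / K"
  proof (rule prob_le_change_of_measure[OF _ _ _ _ K])
    show "pmf (lpp_pmf r a \<beta> m n) X = \<rho> X * pmf (Pi_pmf (sites m n) 0 D) X" for X
    proof (cases "\<forall>v. v \<notin> sites m n \<longrightarrow> X v = 0")
      case True
      have "(\<Prod>v\<in>sites m n. pmf (site_law r a \<beta> v) (X v)) =
          (\<Prod>v\<in>sites m n. (if v \<in> L then (a / a') ^ X v * ((1 - a) / (1 - a')) else 1) * pmf (D v) (X v))"
        using a by (intro prod.cong) (auto simp: D_def L_def site_law_def pmf_Geom power_divide)
      also have "\<dots> = \<rho> X * (\<Prod>v\<in>sites m n. pmf (D v) (X v))"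
        unfolding prod.distrib using AL by (simp add: prod.If_cases Int_absorb1 \<rho>_def)
      finally show ?thesis using True by (simp add: lpp_pmf_def pmf_Pi)
    next
      case False
      then show ?thesis unfolding lpp_pmf_def by (subst (1 2) pmf_Pi_outside) auto
    qed
    show "0 \<le> \<rho> X" for X unfolding \<rho>_def using a by (intro prod_nonneg) auto
    show "0 \<le> B ^ l" using B by simp
    have "(\<integral>\<^sup>+X. ennreal (\<rho> X) \<partial>lpp_pmf r a \<beta> m n) =
        (\<integral>\<^sup>+X. (\<Prod>v\<in>sites m n. if v \<in> L then ennreal ((a / a') ^ X v * ((1 - a) / (1 - a'))) else 1) \<partial>lpp_pmf r a \<beta> m n)"
      unfolding \<rho>_def using a AL by (simp add: prod_ennreal prod.If_cases Int_absorb1)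
    also have "\<dots> = (\<Prod>v\<in>sites m n. \<integral>\<^sup>+x. (if v \<in> L then ennreal ((a / a') ^ x * ((1 - a) / (1 - a'))) else 1) \<partial>site_law r a \<beta> v)"
      unfolding lpp_pmf_def
      by (rule nn_integral_prod_Pi_pmf[where f = "\<lambda>v x. if v \<in> L then ennreal ((a / a') ^ x * ((1 - a) / (1 - a'))) else 1"]) simp
    also have "\<dots> = (\<Prod>v\<in>sites m n. if v \<in> L then ennreal ((1 - a) ^ 2 / ((1 - a') * (1 - a ^ 2 / a'))) else 1)"
    proof (intro prod.cong refl)
      fix v
      have "(\<integral>\<^sup>+x. ennreal ((a / a') ^ x * ((1 - a) / (1 - a'))) \<partial>Geom a) =
          (\<integral>\<^sup>+x. ennreal ((a / a') ^ x) * ennreal ((1 - a) / (1 - a')) \<partial>Geom a)"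
        using a by (intro nn_integral_cong ennreal_mult) auto
      also have "\<dots> = (\<integral>\<^sup>+x. ennreal ((a / a') ^ x) \<partial>Geom a) * ennreal ((1 - a) / (1 - a'))"
        by (rule nn_integral_multc) simp
      also have "\<dots> = ennreal ((1 - a) / (1 - a / a' * a)) * ennreal ((1 - a) / (1 - a'))"
        using a by (subst nn_integral_Geom_power) (auto simp: power2_eq_square)
      also have "\<dots> = ennreal ((1 - a) ^ 2 / ((1 - a') * (1 - a ^ 2 / a')))"
        using a by (simp flip: ennreal_mult add: power2_eq_square mult_ac)
      finally show "(\<integral>\<^sup>+x. (if v \<in> L then ennreal ((a / a') ^ x * ((1 - a) / (1 - a'))) else 1) \<partial>site_law r a \<beta> v) =
          (if v \<in> L then ennreal ((1 - a) ^ 2 / ((1 - a') * (1 - a ^ 2 / a'))) else 1)"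
        by (auto simp: L_def site_law_def)
    qed
    also have "\<dots> = ennreal ((1 - a) ^ 2 / ((1 - a') * (1 - a ^ 2 / a'))) ^ card L"
      using AL by (simp add: prod.If_cases Int_absorb1)
    also have "\<dots> \<le> ennreal B ^ card L"
      using B by (intro power_mono ennreal_leI) auto
    \<comment> \<open>\<open>l\<close> may exceed \<open>m\<close>; then \<open>L\<close> has fewer
      than \<open>l\<close> sites, and \<open>1 \<le> B\<close> fills up the exponent.\<close>
    also have "\<dots> \<le> ennreal B ^ l"
    proof (rule power_increasing)
      have "L \<subseteq> (\<lambda>i. (i, 0)) ` {1..l}" by (auto simp: L_def sites_def)
      then have "card L \<le> card ((\<lambda>i. (i, 0::nat)) ` {1..l})" by (intro card_mono) auto
      also have "\<dots> \<le> card {1..l}" by (rule card_image_le) simp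
      finally show "card L \<le> l" by simp
      show "1 \<le> ennreal B" using B by simp
    qed
    finally show "(\<integral>\<^sup>+X. ennreal (\<rho> X) \<partial>lpp_pmf r a \<beta> m n) \<le> ennreal (B ^ l)"
      using B by (simp add: ennreal_power)
  qed
  also have "measure_pmf.prob (Pi_pmf (sites m n) 0 D) E = measure_pmf.prob (lpp_pmf r a' \<beta> m n) E"
  proof -
    have "map_pmf R (Pi_pmf (sites m n) 0 D) = Pi_pmf A 0 D"
      unfolding R_def using AL by (intro Pi_pmf_subset[symmetric]) auto
    also have "\<dots> = Pi_pmf A 0 (site_law r a' \<beta>)"
      by (intro Pi_pmf_cong) (auto simp: D_def L_def A_def site_law_def)
    also have "\<dots> = map_pmf R (lpp_pmf r a' \<beta> m n)"
      unfolding R_def lpp_pmf_def using AL by (intro Pi_pmf_subset) auto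
    finally have "measure_pmf.prob (map_pmf R (Pi_pmf (sites m n) 0 D)) E =
      measure_pmf.prob (map_pmf R (lpp_pmf r a' \<beta> m n)) E" by simp
    then show ?thesis by (simp add: E_R)
  qed
  finally show ?thesis unfolding E_def .
qed
section \<open>Exponential tail bounds\<close>

text \<open>The mean of the passage time to \<open>(m, n)\<close> in the stationary model with
  parameter \<open>z\<close>: \<open>m\<close> times the mean of \<open>Geom z\<close> plus
  \<open>n\<close> times the mean of \<open>Geom (r / z)\<close>. It is also \<open>z\<close> times
  the derivative of \<open>log_mgf\<close>.\<close>

definition drift :: "real \<Rightarrow> nat \<Rightarrow> nat \<Rightarrow> real \<Rightarrow> real" where
  "drift r m n z = m * z / (1 - z) + n * r / (z - r)"

text \<open>Its increment from \<open>a\<close> to \<open>b\<close> is the logarithm of the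
  exponential moment of the passage time at base \<open>b / a\<close>.\<close>

definition log_mgf :: "real \<Rightarrow> nat \<Rightarrow> nat \<Rightarrow> real \<Rightarrow> real" where
  "log_mgf r m n z = n * ln (1 - r / z) - m * ln (1 - z)"

lemma exp_log_mgf:
  assumes "0 < r" "r < a" "a < 1" "r < b" "b < 1"
  shows "((1 - a) / (1 - b)) ^ m * ((1 - r / b) / (1 - r / a)) ^ n = exp (log_mgf r m n b - log_mgf r m n a)"
proof -
  have p: "0 < 1 - r / a" "0 < 1 - r / b" using assms by auto
  have 1: "((1 - a) / (1 - b)) ^ m = exp (m * (ln (1 - a) - ln (1 - b)))"
    using assms by (simp add: exp_of_nat_mult exp_diff)
  have 2: "((1 - r / b) / (1 - r / a)) ^ n = exp (n * (ln (1 - r / b) - ln (1 - r / a)))"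
    using p by (simp add: exp_of_nat_mult exp_diff)
  show ?thesis
    unfolding 1 2 by (simp add: log_mgf_def exp_add[symmetric] algebra_simps)
qed

lemma DERIV_log_mgf:
  assumes "0 < r" "r < z" "z < 1"
  shows "((\<lambda>z. log_mgf r m n z - K * ln z) has_real_derivative (drift r m n z - K) / z) (at z)"
proof -
  have p: "0 < 1 - r / z" "0 < z" using assms by auto
  have "((\<lambda>z. 1 - r / z) has_real_derivative r / z\<^sup>2) (at z)"
    using p by (auto intro!: derivative_eq_intros simp: power2_eq_square)
  from DERIV_chain2[OF DERIV_ln_divide[OF p(1)] this]
  have d: "((\<lambda>z. ln (1 - r / z)) has_real_derivative r / z\<^sup>2 / (1 - r / z)) (at z)"
    by (simp add: mult.commute)
  have "((\<lambda>z. log_mgf r m n z - K * ln z) has_real_derivative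
      n * (r / z\<^sup>2 / (1 - r / z)) + m * (1 / (1 - z)) - K / z) (at z)"
    unfolding log_mgf_def using assms p
    by (auto intro!: derivative_eq_intros d simp: power2_eq_square mult_ac)
  also have "n * (r / z\<^sup>2 / (1 - r / z)) + m * (1 / (1 - z)) - K / z = (drift r m n z - K) / z"
  proof -
    have "r / z\<^sup>2 / (1 - r / z) = r / (z - r) / z"
      using assms p by (simp add: power2_eq_square field_simps)
    moreover have "1 / (1 - z) = z / (1 - z) / z" using assms p by simp
    ultimately show ?thesis
      using p by (simp add: drift_def diff_divide_distrib add_divide_distrib)
  qed
  finally show ?thesis .
qed

text \<open>A lower bound \<open>K\<close> for the drift makes \<open>log_mgf - K * ln\<close>
  nondecreasing, because its derivative is \<open>(drift - K) / z\<close>. The natural scale is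
  \<open>ln b - ln a\<close>, the exponent of the tilt.\<close>

lemma log_mgf_diff_ge:
  assumes "0 < r" "r < a" "a \<le> b" "b < 1" and K: "\<And>z. a \<le> z \<Longrightarrow> z \<le> b \<Longrightarrow> K \<le> drift r m n z"
  shows "K * (ln b - ln a) \<le> log_mgf r m n b - log_mgf r m n a"
proof -
  have "log_mgf r m n a - K * ln a \<le> log_mgf r m n b - K * ln b"
  proof (rule DERIV_nonneg_imp_nondecreasing[OF assms(3)])
    fix z assume "a \<le> z" "z \<le> b"
    with assms show "\<exists>y. ((\<lambda>z. log_mgf r m n z - K * ln z) has_real_derivative y) (at z) \<and> 0 \<le> y"
      by (intro exI[of _ "(drift r m n z - K) / z"] conjI DERIV_log_mgf) auto
  qed
  then show ?thesis by (simp add: algebra_simps)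
qed

lemma log_mgf_diff_le:
  assumes "0 < r" "r < a" "a \<le> b" "b < 1" and K: "\<And>z. a \<le> z \<Longrightarrow> z \<le> b \<Longrightarrow> drift r m n z \<le> K"
  shows "log_mgf r m n b - log_mgf r m n a \<le> K * (ln b - ln a)"
proof -
  have "log_mgf r m n b - K * ln b \<le> log_mgf r m n a - K * ln a"
  proof (rule DERIV_nonpos_imp_nonincreasing[OF assms(3)])
    fix z assume "a \<le> z" "z \<le> b"
    with assms show "\<exists>y. ((\<lambda>z. log_mgf r m n z - K * ln z) has_real_derivative y) (at z) \<and> y \<le> 0"
      by (intro exI[of _ "(drift r m n z - K) / z"] conjI DERIV_log_mgf) (auto simp: divide_nonpos_nonneg)
  qed
  then show ?thesis by (simp add: algebra_simps)
qed

text \<open>The hypothesis \<open>eq\<close> says that the derivative of the drift vanishes at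
  \<open>p\<close>. Once the common factor \<open>A\<close> is taken out, the numerator of the
  difference is exactly \<open>(1 - r)\<close> times the square of \<open>z - p\<close>, so
  \<open>p\<close> is the minimum.\<close>

lemma drift_diff:
  assumes "r < p" "p < 1" "r < z" "z < 1" and eq: "m * (p - r)\<^sup>2 = n * r * (1 - p)\<^sup>2"
  shows "drift r m n z - drift r m n p = m / (1 - p)\<^sup>2 * (1 - r) * (z - p)\<^sup>2 / ((1 - z) * (z - r))"
proof -
  define A where "A = m / (1 - p)\<^sup>2"
  have m: "real m = A * (1 - p)\<^sup>2" using assms by (simp add: A_def)
  have "n * r = A * (p - r)\<^sup>2" using eq assms by (simp add: A_def field_simps)
  then have "drift r m n z - drift r m n p =
      A * ((1 - p)\<^sup>2 * (z / (1 - z)) + (p - r)\<^sup>2 / (z - r)) - A * ((1 - p)\<^sup>2 * (p / (1 - p)) + (p - r)\<^sup>2 / (p - r))"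
    by (simp add: drift_def m algebra_simps)
  also have "(1 - p)\<^sup>2 * (p / (1 - p)) + (p - r)\<^sup>2 / (p - r) = (1 - p) * p + (p - r)"
    using assms by (simp add: power2_eq_square)
  also have "A * ((1 - p)\<^sup>2 * (z / (1 - z)) + (p - r)\<^sup>2 / (z - r)) - A * ((1 - p) * p + (p - r)) =
      A * (((1 - p)\<^sup>2 * z * (z - r) + (p - r)\<^sup>2 * (1 - z) - ((1 - p) * p + (p - r)) * ((1 - z) * (z - r))) / ((1 - z) * (z - r)))"
  proof -
    have "z / (1 - z) = z * (z - r) / ((1 - z) * (z - r))"
      "(p - r)\<^sup>2 / (z - r) = (p - r)\<^sup>2 * (1 - z) / ((1 - z) * (z - r))"
      "(1 - p) * p + (p - r) = ((1 - p) * p + (p - r)) * ((1 - z) * (z - r)) / ((1 - z) * (z - r))"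
      using assms by simp_all
    then show ?thesis
      by (metis (no_types, opaque_lifting) add_divide_distrib diff_divide_distrib mult.assoc
          right_diff_distrib times_divide_eq_right)
  qed
  also have "(1 - p)\<^sup>2 * z * (z - r) + (p - r)\<^sup>2 * (1 - z) - ((1 - p) * p + (p - r)) * ((1 - z) * (z - r)) =
      (1 - r) * (z - p)\<^sup>2"
    by (simp add: power2_eq_square algebra_simps)
  finally show ?thesis by (simp add: A_def)
qed

section \<open>Centred exponential moments of a geometric weight\<close>

lemma DERIV_ln_ratio:
  assumes "0 < z" "z < 1" "a < 1"
  shows "((\<lambda>z. - ln (1 - z) - a / (1 - a) * ln z) has_real_derivative (z - a) / (z * (1 - a) * (1 - z))) (at z)"
proof -
  have "((\<lambda>z. - ln (1 - z) - a / (1 - a) * ln z) has_real_derivative 1 / (1 - z) - a / (1 - a) * (1 / z)) (at z)"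
    using assms by (auto intro!: derivative_eq_intros)
  also have "1 / (1 - z) - a / (1 - a) * (1 / z) = (z - a) / (z * (1 - a) * (1 - z))"
    using assms by (simp add: field_simps)
  finally show ?thesis .
qed

text \<open>\<open>ln (1 - a) - ln (1 - b)\<close> is the logarithmic moment of
  \<open>Geom a\<close> at the exponent \<open>ln b - ln a\<close>, and the subtracted term is the
  contribution of the mean. The rest vanishes at \<open>b = a\<close>, and its derivative has a
  denominator of at most 1.\<close>

lemma ln_ratio_ge:
  fixes a b :: real
  assumes "0 < a" "a \<le> b" "b < 1"
  shows "(b - a)\<^sup>2 / 2 \<le> ln (1 - a) - ln (1 - b) - a / (1 - a) * (ln b - ln a)"
proof -
  have "(- ln (1 - a) - a / (1 - a) * ln a) - (a - a)\<^sup>2 / 2 \<le> (- ln (1 - b) - a / (1 - a) * ln b) - (b - a)\<^sup>2 / 2"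
  proof (rule DERIV_nonneg_imp_nondecreasing[OF assms(2)])
    fix z assume z: "a \<le> z" "z \<le> b"
    have "z * (1 - a) * (1 - z) \<le> 1"
      using z assms by (intro mult_le_one) auto
    moreover have "0 < z * (1 - a) * (1 - z)" using z assms by simp
    ultimately have "z - a \<le> (z - a) / (z * (1 - a) * (1 - z))"
      using z by (simp add: pos_le_divide_eq mult_left_le)
    moreover have "((\<lambda>z. (z - a)\<^sup>2 / 2) has_real_derivative z - a) (at z)"
      by (auto intro!: derivative_eq_intros)
    then have "((\<lambda>z. (- ln (1 - z) - a / (1 - a) * ln z) - (z - a)\<^sup>2 / 2) has_real_derivative
        (z - a) / (z * (1 - a) * (1 - z)) - (z - a)) (at z)"
      using z assms by (intro DERIV_diff DERIV_ln_ratio) auto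
    ultimately show "\<exists>y. ((\<lambda>z. (- ln (1 - z) - a / (1 - a) * ln z) - (z - a)\<^sup>2 / 2) has_real_derivative y) (at z) \<and> 0 \<le> y"
      by fastforce
  qed
  moreover have "(a - a)\<^sup>2 / 2 = 0" by simp
  ultimately show ?thesis unfolding right_diff_distrib by linarith
qed

lemma ln_ratio_le:
  fixes a b :: real
  assumes "0 < a" "a \<le> b" "b < 1"
  shows "ln (1 - a) - ln (1 - b) - a / (1 - a) * (ln b - ln a) \<le> (b - a)\<^sup>2 / (2 * (a * (1 - a) * (1 - b)))"
proof -
  define C where "C = a * (1 - a) * (1 - b)"
  have C: "0 < C" using assms by (simp add: C_def)
  have "(- ln (1 - b) - a / (1 - a) * ln b) - (b - a)\<^sup>2 / (2 * C) \<le> (- ln (1 - a) - a / (1 - a) * ln a) - (a - a)\<^sup>2 / (2 * C)"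
  proof (rule DERIV_nonpos_imp_nonincreasing[OF assms(2)])
    fix z assume z: "a \<le> z" "z \<le> b"
    have "C \<le> z * (1 - a) * (1 - z)"
      unfolding C_def using z assms by (intro mult_mono) auto
    then have "(z - a) / (z * (1 - a) * (1 - z)) \<le> (z - a) / C"
      using C z by (intro divide_left_mono) auto
    moreover have "((\<lambda>z. (z - a)\<^sup>2 / (2 * C)) has_real_derivative (z - a) / C) (at z)"
      using C by (auto intro!: derivative_eq_intros simp: field_simps)
    then have "((\<lambda>z. (- ln (1 - z) - a / (1 - a) * ln z) - (z - a)\<^sup>2 / (2 * C)) has_real_derivative
        (z - a) / (z * (1 - a) * (1 - z)) - (z - a) / C) (at z)"
      using z assms by (intro DERIV_diff DERIV_ln_ratio) auto
    ultimately show "\<exists>y. ((\<lambda>z. (- ln (1 - z) - a / (1 - a) * ln z) - (z - a)\<^sup>2 / (2 * C)) has_real_derivative y) (at z) \<and> y \<le> 0"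
      by fastforce
  qed
  then show ?thesis by (simp add: right_diff_distrib C_def)
qed

lemma ln_diff_ge_diff:
  fixes a b :: real
  assumes "0 < a" "a \<le> b" "b \<le> 1"
  shows "b - a \<le> ln b - ln a"
proof -
  have "ln a - ln b \<le> a / b - 1"
    using assms ln_le_minus_one[of "a / b"] by (simp add: ln_div)
  also have "\<dots> = - ((b - a) / b)" using assms by (simp add: field_simps)
  finally have "(b - a) / b \<le> ln b - ln a" by simp
  moreover have "b - a \<le> (b - a) / b" using assms by (simp add: pos_le_divide_eq mult_left_le)
  ultimately show ?thesis by linarith
qed

lemma ln_diff_le_div:
  fixes a b :: real
  assumes "0 < a" "a \<le> b"
  shows "ln b - ln a \<le> (b - a) / a"
  using assms ln_le_minus_one[of "b / a"] by (simp add: ln_div diff_divide_distrib)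

section \<open>Tail bounds by tilting\<close>

lemma power_ratio_eq_exp:
  fixes a b :: real
  assumes "0 < a" "0 < b"
  shows "(b / a) ^ k = exp (k * (ln b - ln a))"
  using assms by (simp add: exp_of_nat_mult exp_diff)

text \<open>The sign of \<open>ln b - ln a\<close> is left open, so that the same weight serves
  upper and lower tails.\<close>

lemma one_le_exp_tilt:
  fixes a b :: real
  assumes "0 < a" "0 < b" "(ln b - ln a) * y \<le> (ln b - ln a) * real k"
  shows "1 \<le> exp (- (ln b - ln a) * y) * (b / a) ^ k"
proof -
  have "exp (- (ln b - ln a) * y) * (b / a) ^ k = exp ((ln b - ln a) * k - (ln b - ln a) * y)"
    using assms(1,2) by (simp add: power_ratio_eq_exp exp_add[symmetric] algebra_simps)
  then show ?thesis using assms(3) by simp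
qed

text \<open>Tilting down from \<open>a\<close> to \<open>b\<close> costs the increment of
  \<open>log_mgf\<close> between them. The drift is at least its value at the critical
  \<open>p\<close> wherever \<open>a\<close> and \<open>b\<close> lie relative to \<open>p\<close>,
  so the bound has no error term.\<close>

lemma prob_passage_le:
  assumes r: "0 < r" "r < b" "b < a" "a < 1" "r < p" "p < 1"
    and eq: "m * (p - r)\<^sup>2 = n * r * (1 - p)\<^sup>2"
  shows "measure_pmf.prob (lpp_pmf r a (r / b) m n) {X. real (passage X m n) \<le> x} \<le>
    exp (- (ln a - ln b) * (drift r m n p - x))"
proof -
  let ?w = "exp (- (ln b - ln a) * x)"
  have ln: "ln b \<le> ln a" using r by simp
  have "measure_pmf.prob (lpp_pmf r a (r / b) m n) {X. real (passage X m n) \<le> x} \<le>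
      ?w * exp (log_mgf r m n b - log_mgf r m n a)"
  proof (rule prob_le_exp_moment)
    show "(\<integral>\<^sup>+X. ennreal ((b / a) ^ passage X m n) \<partial>lpp_pmf r a (r / b) m n) \<le>
        ennreal (exp (log_mgf r m n b - log_mgf r m n a))"
      using r by (subst nn_integral_lpp_pmf_power_passage) (auto simp: exp_log_mgf)
    fix X assume "X \<in> {X. real (passage X m n) \<le> x}"
    then have "(ln b - ln a) * x \<le> (ln b - ln a) * passage X m n"
      using ln by (intro mult_left_mono_neg) auto
    then show "1 \<le> ?w * (b / a) ^ passage X m n"
      using r by (intro one_le_exp_tilt) auto
  qed (use r in auto)
  also have "\<dots> \<le> ?w * exp (- (drift r m n p * (ln a - ln b)))"
  proof -
    have "drift r m n p \<le> drift r m n z" if "b \<le> z" "z \<le> a" for z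
    proof -
      have "0 \<le> m / (1 - p)\<^sup>2 * (1 - r) * (z - p)\<^sup>2 / ((1 - z) * (z - r))"
        using that r by simp
      moreover have "drift r m n z - drift r m n p = m / (1 - p)\<^sup>2 * (1 - r) * (z - p)\<^sup>2 / ((1 - z) * (z - r))"
        by (rule drift_diff) (use r that eq in auto)
      ultimately show ?thesis by linarith
    qed
    then have "drift r m n p * (ln a - ln b) \<le> log_mgf r m n a - log_mgf r m n b"
      using r by (intro log_mgf_diff_ge) auto
    then show ?thesis by (intro mult_left_mono) auto
  qed
  also have "\<dots> = exp (- (ln a - ln b) * (drift r m n p - x))"
    by (simp add: exp_add[symmetric] algebra_simps)
  finally show ?thesis .
qed

lemma prob_passage_0_ge:
  assumes r: "0 < a" "a < b" "b < 1" and l: "l \<le> m" and v: "0 \<le> v"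
  shows "measure_pmf.prob (lpp_pmf r a \<beta> m n) {X. l * (a / (1 - a)) + v \<le> passage X l 0} \<le>
    exp (l * ((b - a)\<^sup>2 / (2 * (a * (1 - a) * (1 - b)))) - (b - a) * v)"
proof -
  let ?y = "l * (a / (1 - a)) + v"
  let ?w = "exp (- (ln b - ln a) * ?y)"
  have ln: "ln a \<le> ln b" using r by simp
  have "measure_pmf.prob (lpp_pmf r a \<beta> m n) {X. ?y \<le> passage X l 0} \<le> ?w * ((1 - a) / (1 - b)) ^ l"
  proof (rule prob_le_exp_moment)
    show "(\<integral>\<^sup>+X. ennreal ((b / a) ^ passage X l 0) \<partial>lpp_pmf r a \<beta> m n) \<le> ennreal (((1 - a) / (1 - b)) ^ l)"
      using r l by (subst nn_integral_passage_0) auto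
    fix X assume "X \<in> {X. ?y \<le> passage X l 0}"
    then have "(ln b - ln a) * ?y \<le> (ln b - ln a) * passage X l 0"
      using ln by (intro mult_left_mono) auto
    then show "1 \<le> ?w * (b / a) ^ passage X l 0"
      using r by (intro one_le_exp_tilt) auto
  qed (use r in auto)
  also have "((1 - a) / (1 - b)) ^ l = exp (l * (ln (1 - a) - ln (1 - b)))"
    using r by (intro power_ratio_eq_exp) auto
  also have "?w * \<dots> = exp (l * (ln (1 - a) - ln (1 - b) - a / (1 - a) * (ln b - ln a)) - (ln b - ln a) * v)"
    by (simp add: exp_add[symmetric] algebra_simps diff_divide_distrib)
  also have "\<dots> \<le> exp (l * ((b - a)\<^sup>2 / (2 * (a * (1 - a) * (1 - b)))) - (b - a) * v)"
    unfolding exp_le_cancel_iff using r v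
    by (intro diff_mono mult_left_mono mult_right_mono ln_ratio_le ln_diff_ge_diff) auto
  finally show ?thesis .
qed

text \<open>Removing \<open>l\<close> columns subtracts \<open>l * (ln (1 - a) - ln (1 - b))\<close>
  from the increment of \<open>log_mgf\<close>. By \<open>ln_ratio_ge\<close> this is the
  contribution of the mean of \<open>l\<close> boundary weights plus a quadratic gain, and this gain
  makes late exits unlikely.\<close>

lemma prob_passage_shift_ge:
  assumes r: "0 < r" "r < a" "a < b" "b < 1" and l: "l \<le> m"
    and K: "\<And>z. a \<le> z \<Longrightarrow> z \<le> b \<Longrightarrow> drift r m n z \<le> K"
  shows "measure_pmf.prob (lpp_pmf r a \<beta> m n) {X. y \<le> real (passage (shift l X) (m - l) n)} \<le>
    exp ((ln b - ln a) * (K - y - l * (a / (1 - a))) - l * ((b - a)\<^sup>2 / 2))"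
proof -
  let ?w = "exp (- (ln b - ln a) * y)"
  have ln: "ln a \<le> ln b" using r by simp
  have "measure_pmf.prob (lpp_pmf r a \<beta> m n) {X. y \<le> real (passage (shift l X) (m - l) n)} \<le>
      ?w * exp (log_mgf r (m - l) n b - log_mgf r (m - l) n a)"
  proof (rule prob_le_exp_moment)
    show "(\<integral>\<^sup>+X. ennreal ((b / a) ^ passage (shift l X) (m - l) n) \<partial>lpp_pmf r a \<beta> m n) \<le>
        ennreal (exp (log_mgf r (m - l) n b - log_mgf r (m - l) n a))"
      using nn_integral_passage_shift[where r = r and a = a and b = b and l = l and m = m and n = n and \<beta> = \<beta>] r l by (simp add: exp_log_mgf)
    fix X assume "X \<in> {X. y \<le> real (passage (shift l X) (m - l) n)}"
    then have "(ln b - ln a) * y \<le> (ln b - ln a) * passage (shift l X) (m - l) n"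
      using ln by (intro mult_left_mono) auto
    then show "1 \<le> ?w * (b / a) ^ passage (shift l X) (m - l) n"
      using r by (intro one_le_exp_tilt) auto
  qed (use r in auto)
  also have "\<dots> = exp (- (ln b - ln a) * y + (log_mgf r m n b - log_mgf r m n a) - l * (ln (1 - a) - ln (1 - b)))"
    using l by (simp add: exp_add[symmetric] log_mgf_def of_nat_diff algebra_simps)
  also have "\<dots> \<le> exp (- (ln b - ln a) * y + K * (ln b - ln a) - l * ((b - a)\<^sup>2 / 2 + a / (1 - a) * (ln b - ln a)))"
  proof -
    have "log_mgf r m n b - log_mgf r m n a \<le> K * (ln b - ln a)"
      using r K by (intro log_mgf_diff_le) auto
    moreover have "l * ((b - a)\<^sup>2 / 2 + a / (1 - a) * (ln b - ln a)) \<le> l * (ln (1 - a) - ln (1 - b))"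
      using ln_ratio_ge[of a b] r by (intro mult_left_mono) auto
    ultimately show ?thesis by simp
  qed
  also have "\<dots> = exp ((ln b - ln a) * (K - y - l * (a / (1 - a))) - l * ((b - a)\<^sup>2 / 2))"
    by (simp add: algebra_simps)
  finally show ?thesis .
qed
section \<open>The exit point bound\<close>

lemma inverse_one_minus_le_exp:
  fixes q :: real
  assumes "0 \<le> q" "q \<le> 1 / 2"
  shows "1 / (1 - q) \<le> exp (2 * q)"
proof -
  have "1 \<le> (1 + 2 * q) * (1 - q)"
    using mult_left_mono[of "2 * q" 1 q] assms by (simp add: algebra_simps)
  then have "1 / (1 - q) \<le> 1 + 2 * q"
    using assms by (simp add: pos_divide_le_eq)
  also have "\<dots> \<le> exp (2 * q)" by (rule exp_ge_add_one_self)
  finally show ?thesis .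
qed

text \<open>The denominator equals \<open>(1 - a)\<^sup>2 * (1 - q')\<close> with \<open>q'\<close>
  of order \<open>(a' - a)\<^sup>2\<close>: the cost per site in \<open>prob_passage_cut_le\<close>
  is quadratic in the change of the parameter.\<close>

lemma geometric_chi_square_le:
  fixes a a' :: real
  assumes "0 < a" "a < a'" "a' < 1" and q: "(a' - a)\<^sup>2 / (a' * (1 - a)\<^sup>2) \<le> q" "q \<le> 1 / 2"
  shows "(1 - a)\<^sup>2 / ((1 - a') * (1 - a\<^sup>2 / a')) \<le> exp (2 * q)"
proof -
  define q' where "q' = (a' - a)\<^sup>2 / (a' * (1 - a)\<^sup>2)"
  have q': "0 \<le> q'" using assms by (simp add: q'_def)
  have "(1 - a') * (1 - a\<^sup>2 / a') = (1 - a)\<^sup>2 * (1 - q')"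
  proof -
    have "(1 - a)\<^sup>2 * q' = (a' - a)\<^sup>2 / a'" using assms by (simp add: q'_def)
    then have "(1 - a)\<^sup>2 * (1 - q') = (1 - a)\<^sup>2 - (a' - a)\<^sup>2 / a'" by (simp add: right_diff_distrib)
    also have "\<dots> = (1 - a') * (1 - a\<^sup>2 / a')" using assms by (simp add: field_simps power2_eq_square)
    finally show ?thesis by simp
  qed
  then have "(1 - a)\<^sup>2 / ((1 - a') * (1 - a\<^sup>2 / a')) = 1 / (1 - q')"
    using assms by simp
  also have "\<dots> \<le> exp (2 * q')"
    using q q' unfolding q'_def[symmetric] by (intro inverse_one_minus_le_exp) linarith+
  also have "\<dots> \<le> exp (2 * q)" using q by (simp add: q'_def)
  finally show ?thesis .
qed

text \<open>The parameters \<open>a\<close> and \<open>b\<close> vary separately because the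
  induction passes from \<open>(l, a, b)\<close> to \<open>(2 * l, a', b)\<close>; the admissible
  window doubles with \<open>l\<close>, so \<open>a'\<close> fits into it. Here \<beta> scales the
  tilt of the shifted model, \<gamma> the margin in the thresholds and \<eta> the window of
  parameters. The condition with 5 pays for a sum of five exponentials and is inherited by
  \<open>2 * l\<close>.\<close>

lemma exits_after_tail:
  fixes r \<tau> \<beta> \<gamma> \<eta> c p a b :: real
  assumes r: "0 < r" "r < 1" and \<tau>: "0 < \<tau>" "\<tau> \<le> 1"
    and \<beta>: "0 < \<beta>" "\<beta> \<le> \<tau> / 8" "\<beta> \<le> r * \<tau> ^ 4 / 128"
    and \<gamma>: "\<gamma> = r * \<beta> / 16" and \<eta>: "0 < \<eta>" "\<eta> \<le> \<gamma> * r * \<tau>\<^sup>2 / 288" and c: "c = \<eta> * \<gamma> / 8"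
    and p: "r + \<tau> \<le> p" "p \<le> 1 - \<tau>" and eq: "m * (p - r)\<^sup>2 = n * r * (1 - p)\<^sup>2"
  shows "0 < l \<Longrightarrow> 5 \<le> exp (c * (real l ^ 3 / (real m + real n)\<^sup>2)) \<Longrightarrow>
    \<bar>a - p\<bar> \<le> \<eta> * (l / (real m + real n)) \<Longrightarrow> \<bar>b - p\<bar> \<le> \<eta> * (l / (real m + real n)) \<Longrightarrow>
    measure_pmf.prob (lpp_pmf r a (r / b) m n) {X. exits_after X m n l} \<le> exp (- c * (real l ^ 3 / (real m + real n)\<^sup>2))"
proof (induction "m - l" arbitrary: l a b rule: less_induct)
  case less
  show ?case
  proof (cases "l < m")
    case False
    then show ?thesis by (simp add: exits_after_def)
  next
    case True
    define N where "N = real m + real n"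
    \<comment> \<open>\<open>h\<close> is the scale of all changes of parameters, and every exponent
      below is a multiple of \<open>u = N * h ^ 3\<close>.\<close>
    define h where "h = l / N"
    define u where "u = real l ^ 3 / N\<^sup>2"
    have N: "0 < N" "real m \<le> N" using True by (auto simp: N_def)
    have h: "0 < h" "h \<le> 1" "l = N * h" using True less.prems N by (auto simp: h_def)
    have u: "u = N * h ^ 3" using N by (simp add: u_def h_def power3_eq_cube power2_eq_square)
    have u0: "0 < u" using N h by (simp add: u)
    have \<gamma>0: "0 < \<gamma>" "\<gamma> \<le> \<beta>" using mult_right_mono[of r 1 \<beta>] r \<beta>(1) by (simp_all add: \<gamma>)
    have c0: "0 < c" using \<eta>(1) \<gamma>0 by (simp add: c)
    have sq: "\<tau>\<^sup>2 \<le> 1" "r * \<tau>\<^sup>2 \<le> 1" "0 < r * \<tau>\<^sup>2"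
    proof -
      show "\<tau>\<^sup>2 \<le> 1" using \<tau> by (intro power_le_one) auto
      then have "r * \<tau>\<^sup>2 \<le> 1 * 1" using r by (intro mult_mono) auto
      then show "r * \<tau>\<^sup>2 \<le> 1" by simp
      show "0 < r * \<tau>\<^sup>2" using r \<tau> by simp
    qed
    have \<eta>': "\<eta> \<le> \<gamma> / 288" "\<eta> \<le> \<beta>" "\<eta> \<le> \<tau> / 8"
    proof -
      have "\<gamma> * (r * \<tau>\<^sup>2) \<le> \<gamma> * 1" using \<gamma>0 sq by (intro mult_left_mono) auto
      then show "\<eta> \<le> \<gamma> / 288" using \<eta> by (simp add: mult.assoc)
      then show "\<eta> \<le> \<beta>" "\<eta> \<le> \<tau> / 8" using \<gamma>0 \<beta> by linarith+
    qed
    have \<eta>h: "0 < \<eta> * h" "\<eta> * h \<le> \<eta>" "\<beta> * h \<le> \<beta>" "0 < \<beta> * h"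
      using h \<eta> \<beta> by (auto intro: mult_left_le)
    \<comment> \<open>The largest parameter in the window for \<open>2 * l\<close>; it exceeds both
      \<open>a\<close> and \<open>b\<close> by at least \<open>\<eta> * h\<close>.\<close>
    define a' where "a' = p + 2 * (\<eta> * h)"
    have ab: "p - \<eta> * h \<le> a" "a \<le> p + \<eta> * h" "p - \<eta> * h \<le> b" "b \<le> p + \<eta> * h"
      using less.prems(3,4) by (auto simp: N_def[symmetric] h_def[symmetric] abs_le_iff)
    have rg: "r + \<tau> / 2 \<le> a" "a \<le> 1 - 3 * \<tau> / 4" "r + \<tau> / 2 \<le> b" "b \<le> 1 - 3 * \<tau> / 4" "a' \<le> 1 - \<tau> / 2"
        "r + \<tau> / 2 \<le> a'" "a + \<eta> * h \<le> a'" "b + \<eta> * h \<le> a'" "a' - a \<le> 3 * (\<eta> * h)"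
      using ab p \<eta>h \<eta>' by (auto simp: a'_def)
    define M0 where "M0 = drift r m n p"
    \<comment> \<open>The margin by which each of the passage time and the boundary sum may deviate.
      It is of the order \<open>l ^ 2 / N\<close> of the loss caused by a late exit, with a small
      factor \<gamma>.\<close>
    define v where "v = \<gamma> * N * h\<^sup>2"
    define x where "x = M0 - v"
    define y where "y = l * (a / (1 - a)) + v"
    have v0: "0 < v" using \<gamma>0 N h by (simp add: v_def)
    let ?P = "lpp_pmf r a (r / b) m n" and ?P' = "lpp_pmf r a' (r / b) m n"
    let ?E1 = "{X. real (passage (cut (2 * l) X) m n) \<le> x}"
    let ?E2 = "{X. y \<le> real (passage X l 0)}"
    let ?E3 = "{X. x - y \<le> real (passage (shift l X) (m - l) n)}"
    \<comment> \<open>On the interval of the tilt, \<open>z\<close> stays within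
      \<open>2 * \<beta> * h\<close> of \<open>p\<close>, so the drift exceeds its minimum
      \<open>M0\<close> only to second order.\<close>
    have drift_le: "drift r m n z \<le> M0 + N * (4 / \<tau> ^ 4) * ((2 * \<beta> * h)\<^sup>2)"
      if z: "a \<le> z" "z \<le> a + \<beta> * h" for z
    proof -
      have z': "r + \<tau> / 2 \<le> z" "z \<le> 1 - \<tau> / 2" "\<bar>z - p\<bar> \<le> 2 * \<beta> * h"
      proof -
        have "\<eta> * h \<le> \<beta> * h" using \<eta>' h by (intro mult_right_mono) auto
        then show "\<bar>z - p\<bar> \<le> 2 * \<beta> * h" using z ab by (simp add: abs_le_iff)
        show "r + \<tau> / 2 \<le> z" "z \<le> 1 - \<tau> / 2" using z rg \<eta>h \<beta> by linarith+
      qed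
      have "drift r m n z - M0 = m / (1 - p)\<^sup>2 * (1 - r) * (z - p)\<^sup>2 / ((1 - z) * (z - r))"
        unfolding M0_def by (rule drift_diff) (use r \<tau> p z' eq in auto)
      also have "\<dots> \<le> N / \<tau>\<^sup>2 * 1 * (2 * \<beta> * h)\<^sup>2 / (\<tau> / 2 * (\<tau> / 2))"
      proof (intro frac_le mult_mono)
        show "(z - p)\<^sup>2 \<le> (2 * \<beta> * h)\<^sup>2" using power_mono[OF z'(3), of 2] by simp
        show "\<tau>\<^sup>2 \<le> (1 - p)\<^sup>2" using p \<tau> by (intro power_mono) auto
      qed (use r \<tau> p z' N in auto)
      also have "\<dots> = N * (4 / \<tau> ^ 4) * ((2 * \<beta> * h)\<^sup>2)"
        using \<tau> by (simp add: field_simps power2_eq_square power4_eq_xxxx)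
      finally show ?thesis by simp
    qed
    have T3: "measure_pmf.prob ?P ?E3 \<le> exp (- 2 * c * u)"
    proof -
      \<comment> \<open>The gain of this tilt is \<open>u * \<beta>\<^sup>2 / 2\<close>. The
        curvature of the drift and the two margins \<open>v\<close> each cost at most
        \<open>u * \<beta>\<^sup>2 / 8\<close>, by the bound on \<beta> and the choice of
        \<gamma>.\<close>
      let ?b = "a + \<beta> * h"
      let ?D = "N * (4 / \<tau> ^ 4) * ((2 * \<beta> * h)\<^sup>2)"
      have b: "?b < 1" "a < ?b" using rg(2) \<eta>h(3,4) \<beta>(2) \<tau> by linarith+
      have "measure_pmf.prob ?P ?E3 \<le>
          exp ((ln ?b - ln a) * (M0 + ?D - (x - y) - l * (a / (1 - a))) - l * ((?b - a)\<^sup>2 / 2))"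
        by (rule prob_passage_shift_ge) (use r \<tau> rg b True drift_le in auto)
      also have "M0 + ?D - (x - y) - l * (a / (1 - a)) = ?D + 2 * v"
        by (simp add: x_def y_def)
      also have "(ln ?b - ln a) * (?D + 2 * v) - l * ((?b - a)\<^sup>2 / 2) \<le> - 2 * c * u"
      proof -
        have "ln ?b - ln a \<le> (?b - a) / a"
          by (rule ln_diff_le_div) (use r \<tau> rg b in auto)
        also have "\<dots> \<le> \<beta> * h / r" using \<beta> h r rg \<tau> by (auto intro!: divide_left_mono)
        finally have "(ln ?b - ln a) * (?D + 2 * v) \<le> \<beta> * h / r * (?D + 2 * v)"
          using N v0 by (intro mult_right_mono) auto
        also have "\<dots> = u * (\<beta> * (16 * \<beta> / \<tau> ^ 4 * \<beta> + 2 * \<gamma>) / r)"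
          by (simp add: u v_def power2_eq_square power3_eq_cube field_simps)
        also have "\<dots> \<le> u * (\<beta> * (r / 8 * \<beta> + 2 * \<gamma>) / r)"
        proof -
          have "16 * \<beta> / \<tau> ^ 4 \<le> r / 8" using \<beta> \<tau> by (simp add: field_simps)
          then show ?thesis using u0 \<beta> r
            by (intro mult_left_mono divide_right_mono add_right_mono mult_right_mono) auto
        qed
        also have "\<dots> = u * \<beta>\<^sup>2 / 4" using r by (simp add: \<gamma> power2_eq_square field_simps)
        finally have 1: "(ln ?b - ln a) * (?D + 2 * v) \<le> u * \<beta>\<^sup>2 / 4" .
        have 2: "l * ((?b - a)\<^sup>2 / 2) = u * \<beta>\<^sup>2 / 2"
          by (simp add: h(3) u power2_eq_square power3_eq_cube)
        have "\<eta> * \<gamma> \<le> \<beta>\<^sup>2" unfolding power2_eq_square using \<eta>' \<gamma>0 \<beta> by (intro mult_mono) auto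
        then have "2 * c * u \<le> u * \<beta>\<^sup>2 / 4" using u0 by (simp add: c)
        with 1 2 show ?thesis by linarith
      qed
      finally show ?thesis by simp
    qed
    have T2: "measure_pmf.prob ?P ?E2 \<le> exp (- 2 * c * u)"
    proof -
      define w where "w = r * \<tau>\<^sup>2 / 4"
      have w: "0 < w" "w \<le> 1" using sq by (auto simp: w_def)
      \<comment> \<open>The minimizer \<open>v * w / l\<close> of
        \<open>l * (e\<^sup>2 / (2 * w)) - e * v\<close>, where \<open>w\<close> is a lower bound
        for \<open>a * (1 - a) * (1 - (a + e))\<close>.\<close>
      define e where "e = \<gamma> * h * w"
      have e: "0 < e" "e \<le> \<tau> / 8"
      proof -
        show "0 < e" using \<gamma>0 h w by (simp add: e_def)
        have "e \<le> \<gamma> * 1 * 1" unfolding e_def using \<gamma>0 h w by (intro mult_mono) auto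
        then show "e \<le> \<tau> / 8" using \<gamma>0 \<beta> by simp
      qed
      have "measure_pmf.prob ?P ?E2 \<le>
          exp (l * ((a + e - a)\<^sup>2 / (2 * (a * (1 - a) * (1 - (a + e))))) - (a + e - a) * v)"
        unfolding y_def by (rule prob_passage_0_ge) (use r \<tau> rg e v0 True in auto)
      also have "l * ((a + e - a)\<^sup>2 / (2 * (a * (1 - a) * (1 - (a + e))))) \<le> l * (e\<^sup>2 / (2 * w))"
      proof -
        have "w = r * (\<tau> / 2) * (\<tau> / 2)" by (simp add: w_def power2_eq_square)
        also have "\<dots> \<le> a * (1 - a) * (1 - (a + e))"
          using r \<tau> rg e by (intro mult_mono) auto
        finally have "2 * w \<le> 2 * (a * (1 - a) * (1 - (a + e)))" by simp
        then show ?thesis using w by (intro mult_left_mono frac_le) auto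
      qed
      also have "l * (e\<^sup>2 / (2 * w)) - (a + e - a) * v = - (\<gamma>\<^sup>2 * w / 2) * u"
        using w by (simp add: h(3) u v_def e_def power2_eq_square power3_eq_cube field_simps)
      also have "- (\<gamma>\<^sup>2 * w / 2) * u \<le> - (2 * c) * u"
      proof -
        have "\<eta> \<le> \<gamma> * (2 * w)" using \<eta> \<gamma>0 w by (simp add: w_def)
        then have "\<eta> * \<gamma> \<le> \<gamma> * (2 * w) * \<gamma>" using \<gamma>0 by (intro mult_right_mono) auto
        then have "2 * c \<le> \<gamma>\<^sup>2 * w / 2" by (simp add: c power2_eq_square mult_ac)
        then show ?thesis using u0 by (intro mult_right_mono) auto
      qed
      finally show ?thesis by simp
    qed
    have T1: "measure_pmf.prob ?P ?E1 \<le> 3 * exp (- 2 * c * u)"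
    proof -
      \<comment> \<open>The bound of \<open>geometric_chi_square_le\<close>, with
        \<open>a' - a\<close> at most \<open>3 * (\<eta> * h)\<close>, \<open>a'\<close> at least
        \<open>r\<close> and \<open>1 - a\<close> at least \<open>\<tau> / 2\<close>.\<close>
      define B where "B = exp (72 * (\<eta> * h)\<^sup>2 / (r * \<tau>\<^sup>2))"
      \<comment> \<open>\<open>K\<close> balances the two terms: \<open>B ^ (2 * l)\<close> is at
        most \<open>exp (4 * c * u)\<close>, and the probability under \<open>?P'\<close> is at most
        \<open>2 * exp (- 8 * c * u)\<close>. Both then end at the exponent
        \<open>- 2 * c * u\<close>.\<close>
      define K where "K = exp (6 * c * u)"
      have B1: "1 \<le> B" unfolding B_def using r by simp
      have q: "36 * (\<eta> * h)\<^sup>2 / (r * \<tau>\<^sup>2) \<le> 1 / 2"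
      proof -
        have "(\<eta> * h)\<^sup>2 \<le> \<eta> * 1"
          unfolding power2_eq_square using \<eta>h \<eta>' \<tau> by (intro mult_mono) auto
        also have "\<dots> \<le> r * \<tau>\<^sup>2 / 72"
        proof -
          have "\<gamma> * (r * \<tau>\<^sup>2) \<le> 1 * (r * \<tau>\<^sup>2)" using \<gamma>0 \<beta> \<tau> r by (intro mult_right_mono) auto
          then show ?thesis using \<eta> sq by (simp add: mult.assoc)
        qed
        finally show ?thesis using sq by (simp add: field_simps)
      qed
      have B2: "(1 - a)\<^sup>2 / ((1 - a') * (1 - a\<^sup>2 / a')) \<le> B"
      proof -
        have "(a' - a)\<^sup>2 / (a' * (1 - a)\<^sup>2) \<le> (3 * (\<eta> * h))\<^sup>2 / (r * (\<tau> / 2)\<^sup>2)"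
        proof (intro frac_le mult_mono power_mono)
        qed (use r \<tau> rg \<eta>h in auto)
        also have "\<dots> = 36 * (\<eta> * h)\<^sup>2 / (r * \<tau>\<^sup>2)"
          using r \<tau> by (simp add: field_simps power2_eq_square)
        finally have "(1 - a)\<^sup>2 / ((1 - a') * (1 - a\<^sup>2 / a')) \<le> exp (2 * (36 * (\<eta> * h)\<^sup>2 / (r * \<tau>\<^sup>2)))"
          using q by (intro geometric_chi_square_le) (use r \<tau> rg \<eta>h in auto)
        then show ?thesis by (simp add: B_def)
      qed
      have a2: "a\<^sup>2 < a'"
      proof -
        have "a\<^sup>2 \<le> a * 1" unfolding power2_eq_square using r \<tau> rg by (intro mult_left_mono) auto
        then show ?thesis using rg \<eta>h by simp
      qed
      have 1: "measure_pmf.prob ?P ?E1 \<le> K * measure_pmf.prob ?P' ?E1 + B ^ (2 * l) / K"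
        by (rule prob_passage_cut_le) (use r \<tau> rg a2 B1 B2 in \<open>auto simp: K_def\<close>)
      have 2: "B ^ (2 * l) / K \<le> exp (- 2 * c * u)"
      proof -
        have "B ^ (2 * l) = exp (u * (144 * \<eta>\<^sup>2 / (r * \<tau>\<^sup>2)))"
          unfolding B_def exp_of_nat_mult[symmetric]
          by (simp add: h(3) u power2_eq_square power3_eq_cube field_simps)
        \<comment> \<open>Here the upper bound on \<eta> is used in full: the cost is quadratic in
          \<eta>, while \<open>c\<close> is linear in it.\<close>
        also have "\<dots> \<le> exp (u * (4 * c))"
        proof -
          have "144 * \<eta> * \<eta> \<le> 144 * \<eta> * (\<gamma> * r * \<tau>\<^sup>2 / 288)" using \<eta> by (intro mult_left_mono) auto
          then have "144 * \<eta>\<^sup>2 \<le> 4 * c * (r * \<tau>\<^sup>2)" by (simp add: c power2_eq_square mult_ac)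
          then have "144 * \<eta>\<^sup>2 / (r * \<tau>\<^sup>2) \<le> 4 * c" using sq by (simp add: pos_divide_le_eq)
          then show ?thesis unfolding exp_le_cancel_iff using u0 by (intro mult_left_mono) auto
        qed
        finally have "B ^ (2 * l) / K \<le> exp (u * (4 * c)) / K"
          by (intro divide_right_mono) (auto simp: K_def)
        also have "\<dots> = exp (- 2 * c * u)" by (simp add: K_def exp_diff[symmetric] mult_ac)
        finally show ?thesis .
      qed
      have "measure_pmf.prob ?P' ?E1 \<le> 2 * exp (- 8 * c * u)"
      proof -
        have "measure_pmf.prob ?P' ?E1 \<le> measure_pmf.prob ?P' ({X. real (passage X m n) \<le> x} \<union> {X. exits_after X m n (2 * l)})"
        proof (rule measure_pmf.finite_measure_mono)
          show "?E1 \<subseteq> {X. real (passage X m n) \<le> x} \<union> {X. exits_after X m n (2 * l)}"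
          proof
            fix X assume "X \<in> ?E1"
            then show "X \<in> {X. real (passage X m n) \<le> x} \<union> {X. exits_after X m n (2 * l)}"
              using passage_cut_or_exits_after[of X m n "2 * l"] by auto
          qed
        qed simp
        also have "\<dots> \<le> measure_pmf.prob ?P' {X. real (passage X m n) \<le> x} + measure_pmf.prob ?P' {X. exits_after X m n (2 * l)}"
          by (rule measure_Un_le) auto
        also have "measure_pmf.prob ?P' {X. real (passage X m n) \<le> x} \<le> exp (- 8 * c * u)"
        proof -
          have "measure_pmf.prob ?P' {X. real (passage X m n) \<le> x} \<le> exp (- (ln a' - ln b) * (drift r m n p - x))"
            by (rule prob_passage_le) (use r \<tau> rg p \<eta>h eq in auto)
          also have "drift r m n p - x = v" by (simp add: x_def M0_def)
          also have "- (ln a' - ln b) * v \<le> - (\<eta> * h) * v"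
          proof -
            have "a' - b \<le> ln a' - ln b" by (rule ln_diff_ge_diff) (use r \<tau> rg \<eta>h in auto)
            then show ?thesis using v0 rg by (intro mult_right_mono) auto
          qed
          \<comment> \<open>The parameter gap \<open>\<eta> * h\<close> times the margin
            \<open>v\<close> is \<open>\<eta> * \<gamma> * u\<close>, which explains the value of
            \<open>c\<close>.\<close>
          also have "- (\<eta> * h) * v = - 8 * c * u"
            by (simp add: c u v_def power2_eq_square power3_eq_cube)
          finally show ?thesis by simp
        qed
        \<comment> \<open>The induction hypothesis at \<open>2 * l\<close>: doubling
          \<open>l\<close> multiplies \<open>u\<close> by 8.\<close>
        also have "measure_pmf.prob ?P' {X. exits_after X m n (2 * l)} \<le> exp (- 8 * c * u)"
        proof -
          have l2: "real (2 * l) ^ 3 / (real m + real n)\<^sup>2 = 8 * u"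
            by (simp add: u_def N_def power_mult_distrib)
          have h2: "real (2 * l) / (real m + real n) = 2 * h" by (simp add: h_def N_def)
          have "5 \<le> exp (c * u)" using less.prems(2) by (simp add: u_def N_def)
          also have "\<dots> \<le> exp (c * (8 * u))" using c0 u0 by simp
          finally have "measure_pmf.prob ?P' {X. exits_after X m n (2 * l)} \<le> exp (- c * (8 * u))"
            unfolding l2[symmetric]
          proof (intro less.hyps)
            show "\<bar>a' - p\<bar> \<le> \<eta> * (real (2 * l) / (real m + real n))"
              unfolding h2 using \<eta>h by (simp add: a'_def)
            show "\<bar>b - p\<bar> \<le> \<eta> * (real (2 * l) / (real m + real n))"
              unfolding h2 using \<eta>h ab by (simp add: abs_le_iff)
          qed (use True less.prems in auto)
          then show ?thesis by (simp add: mult_ac)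
        qed
        finally show ?thesis by simp
      qed
      then have "K * measure_pmf.prob ?P' ?E1 \<le> K * (2 * exp (- 8 * c * u))"
        by (intro mult_left_mono) (auto simp: K_def)
      also have "\<dots> = 2 * exp (- 2 * c * u)" by (simp add: K_def exp_add[symmetric])
      finally show ?thesis using 1 2 by linarith
    qed
    \<comment> \<open>If the boundary part is below \<open>y\<close> and the shifted part below
      \<open>x - y\<close>, the passage time is below \<open>x\<close>, and cutting only lowers
      it.\<close>
    have sub: "{X. exits_after X m n l} \<subseteq> ?E1 \<union> ?E2 \<union> ?E3"
    proof
      fix X assume "X \<in> {X. exits_after X m n l}"
      then have "real (passage X m n) \<le> real (passage X l 0) + real (passage (shift l X) (m - l) n)"
        by (simp add: exits_after_def flip: of_nat_add)
      moreover have "real (passage (cut (2 * l) X) m n) \<le> real (passage X m n)"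
        using passage_cut_le[of "2 * l" X m n] by simp
      ultimately show "X \<in> ?E1 \<union> ?E2 \<union> ?E3" by simp linarith
    qed
    have "measure_pmf.prob ?P {X. exits_after X m n l} \<le> measure_pmf.prob ?P (?E1 \<union> ?E2 \<union> ?E3)"
      by (rule measure_pmf.finite_measure_mono[OF sub]) simp
    also have "\<dots> \<le> measure_pmf.prob ?P (?E1 \<union> ?E2) + measure_pmf.prob ?P ?E3"
      by (rule measure_Un_le) auto
    also have "measure_pmf.prob ?P (?E1 \<union> ?E2) \<le> measure_pmf.prob ?P ?E1 + measure_pmf.prob ?P ?E2"
      by (rule measure_Un_le) auto
    finally have "measure_pmf.prob ?P {X. exits_after X m n l} \<le> 5 * exp (- 2 * c * u)"
      using T1 T2 T3 by simp
    \<comment> \<open>Half of the exponent is given up for the factor 5 = 3 + 1 + 1.\<close>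
    also have "\<dots> \<le> exp (c * u) * exp (- 2 * c * u)"
      using less.prems(2) by (intro mult_right_mono) (auto simp: u_def N_def)
    also have "\<dots> = exp (- c * u)" by (simp add: exp_add[symmetric])
    finally show ?thesis by (simp add: u_def N_def)
  qed
qed
section \<open>Exit points in terms of the recursion\<close>

text \<open>Reflection in the diagonal turns exits from the vertical axis into exits from the
  horizontal axis.\<close>

lemma passage_transpose: "passage (X \<circ> prod.swap) i j = passage X j i"
  by (induction X j i rule: passage.induct) (simp_all add: max.commute)

definition quadrant ::
  "(int \<times> int \<Rightarrow> nat) \<Rightarrow> (int \<times> int \<Rightarrow> nat) \<Rightarrow> (int \<times> int \<Rightarrow> nat) \<Rightarrow> nat \<times> nat \<Rightarrow> nat" where
  "quadrant w a b v = (let u = (int (fst v), int (snd v)) in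
     if snd v = 0 then a u else if fst v = 0 then b u else w u)"

lemma passage_step_right: "0 < j \<Longrightarrow> X (Suc i, j) + passage X i j \<le> passage X (Suc i) j"
  by (cases j) auto

lemma passage_step_up: "0 < i \<Longrightarrow> X (i, Suc j) + passage X i j \<le> passage X i (Suc j)"
  by (cases i) auto

lemma up_right_path_snoc:
  "up_right_path x v \<pi> \<Longrightarrow> u = v + (1, 0) \<or> u = v + (0, 1) \<Longrightarrow> up_right_path x u (\<pi> @ [u])"
  by (auto simp: up_right_path_def successively_append_iff)

lemma up_right_path_exists: "\<exists>\<pi>. up_right_path (i, j) (i + int d, j + int e) \<pi>"
proof (induction d)
  case 0
  show ?case
  proof (induction e)
    case 0
    have "up_right_path (i, j) (i, j) [(i, j)]" by (simp add: up_right_path_def)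
    then show ?case by auto
  next
    case (Suc e)
    then obtain \<pi> where "up_right_path (i, j) (i + int 0, j + int e) \<pi>" by blast
    from up_right_path_snoc[OF this, of "(i + int 0, j + int (Suc e))"] show ?case by auto
  qed
next
  case (Suc d)
  then obtain \<pi> where "up_right_path (i, j) (i + int d, j + int e) \<pi>" by blast
  from up_right_path_snoc[OF this, of "(i + int (Suc d), j + int e)"] show ?case by auto
qed

text \<open>A potential argument: at every step \<open>g\<close> grows by at least the weight
  collected there. \<open>g0\<close> is the boundary part collected before the path enters the
  bulk.\<close>

lemma path_sum_le:
  assumes "up_right_path (int i0, int j0) (int m, int n) \<pi>"
    and base: "w (int i0, int j0) + g0 \<le> (g i0 j0 :: nat)"
    and right: "\<And>i j. i0 \<le> i \<Longrightarrow> j0 \<le> j \<Longrightarrow> w (int (Suc i), int j) + g i j \<le> g (Suc i) j"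
    and up: "\<And>i j. i0 \<le> i \<Longrightarrow> j0 \<le> j \<Longrightarrow> w (int i, int (Suc j)) + g i j \<le> g i (Suc j)"
  shows "g0 + sum_list (map w \<pi>) \<le> g m n"
proof -
  have "\<pi> \<noteq> [] \<Longrightarrow> hd \<pi> = (int i0, int j0) \<Longrightarrow>
      successively (\<lambda>u v. v = u + (1, 0) \<or> v = u + (0, 1)) \<pi> \<Longrightarrow>
      \<exists>i\<ge>i0. \<exists>j\<ge>j0. last \<pi> = (int i, int j) \<and> g0 + sum_list (map w \<pi>) \<le> g i j"
  proof (induction \<pi> rule: rev_induct)
    case (snoc v \<pi>)
    show ?case
    proof (cases "\<pi> = []")
      case True
      then show ?thesis using snoc.prems base by auto
    next
      case False
      with snoc obtain i j where ij: "i0 \<le> i" "j0 \<le> j" "last \<pi> = (int i, int j)"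
        "g0 + sum_list (map w \<pi>) \<le> g i j"
        by (auto simp: successively_append_iff)
      have "v = (int (Suc i), int j) \<or> v = (int i, int (Suc j))"
        using snoc.prems False ij(3) by (auto simp: successively_append_iff)
      then show ?thesis
      proof
        assume v: "v = (int (Suc i), int j)"
        have "g0 + sum_list (map w (\<pi> @ [v])) \<le> g (Suc i) j"
          using ij(4) right[OF ij(1,2)] by (simp add: v)
        then show ?thesis using ij v by (intro exI[of _ "Suc i"] conjI exI[of _ j]) auto
      next
        assume v: "v = (int i, int (Suc j))"
        have "g0 + sum_list (map w (\<pi> @ [v])) \<le> g i (Suc j)"
          using ij(4) up[OF ij(1,2)] by (simp add: v)
        then show ?thesis using ij v by (intro exI[of _ i] conjI exI[of _ "Suc j"]) auto
      qed
    qed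
  qed simp
  then show ?thesis using assms(1) by (auto simp: up_right_path_def)
qed

lemma passage_shift_le:
  "passage X l 0 + passage (shift l X) d n \<le> passage X (l + d) n"
proof (induction d arbitrary: n)
  case 0
  have "passage (shift l X) 0 n = 0" by (induction n) (simp_all add: shift_def)
  moreover have "passage X l 0 \<le> passage X l n"
    by (induction n) (use passage_le_Suc2 le_trans in blast)+
  ultimately show ?case by simp
next
  case (Suc d)
  show ?case
  proof (induction n)
    case 0
    show ?case using passage_add_0[of X l "Suc d"] by simp
  next
    case (Suc n)
    then show ?case
      using \<open>\<And>n. _ \<le> passage X (l + d) n\<close>[of "Suc n"] by (simp add: shift_def)
  qed
qed

context
  fixes w a b :: "int \<times> int \<Rightarrow> nat"
begin

lemma quadrant_bulk: "0 < i \<Longrightarrow> 0 < j \<Longrightarrow> w (int i, int j) = quadrant w a b (i, j)"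
  by (simp add: quadrant_def)

text \<open>The path starts in column \<open>k > l\<close> and never meets the column that
  \<open>shift l\<close> sets to 0; the boundary sum up to \<open>k\<close> splits at
  \<open>l\<close>.\<close>

lemma horizontal_exit_le:
  assumes "up_right_path (int k, 1) (int m, int n) \<pi>" "l < k"
  shows "passage (quadrant w a b) k 0 + sum_list (map w \<pi>) \<le> passage (quadrant w a b) l 0 + passage (shift l (quadrant w a b)) (m - l) n"
proof (rule path_sum_le[where g = "\<lambda>i j. passage (quadrant w a b) l 0 + passage (shift l (quadrant w a b)) (i - l) j"])
  show "up_right_path (int k, int 1) (int m, int n) \<pi>" using assms by simp
  have k: "passage (quadrant w a b) k 0 = passage (quadrant w a b) l 0 + passage (shift l (quadrant w a b)) (k - l) 0"
    using passage_add_0[of "quadrant w a b" l "k - l"] assms by simp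
  have sh: "w (int i, int j) = shift l (quadrant w a b) (i - l, j)" if "l < i" "0 < j" for i j
    using that by (simp add: quadrant_bulk shift_def)
  show "w (int k, int 1) + passage (quadrant w a b) k 0 \<le> passage (quadrant w a b) l 0 + passage (shift l (quadrant w a b)) (k - l) 1"
    using passage_step_up[of "k - l" "shift l (quadrant w a b)" 0] assms by (simp add: k sh[of k 1, simplified])
  fix i j :: nat assume ij: "k \<le> i" "1 \<le> j"
  show "w (int (Suc i), int j) + (passage (quadrant w a b) l 0 + passage (shift l (quadrant w a b)) (i - l) j) \<le> passage (quadrant w a b) l 0 + passage (shift l (quadrant w a b)) (Suc i - l) j"
    using passage_step_right[of j "shift l (quadrant w a b)" "i - l"] ij assms sh[of "Suc i" j] by (simp add: Suc_diff_le)
  show "w (int i, int (Suc j)) + (passage (quadrant w a b) l 0 + passage (shift l (quadrant w a b)) (i - l) j) \<le> passage (quadrant w a b) l 0 + passage (shift l (quadrant w a b)) (i - l) (Suc j)"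
    using passage_step_up[of "i - l" "shift l (quadrant w a b)" j] ij assms sh[of i "Suc j"] by simp
qed

lemma vertical_exit_le:
  assumes "up_right_path (1, int k) (int m, int n) \<pi>" "l < k"
  shows "passage (quadrant w a b) 0 k + sum_list (map w \<pi>) \<le> passage (quadrant w a b) 0 l + passage (shift l (quadrant w a b \<circ> prod.swap)) (n - l) m"
proof (rule path_sum_le[where g = "\<lambda>i j. passage (quadrant w a b) 0 l + passage (shift l (quadrant w a b \<circ> prod.swap)) (j - l) i"])
  let ?Y = "quadrant w a b \<circ> prod.swap"
  show "up_right_path (int 1, int k) (int m, int n) \<pi>" using assms by simp
  have k: "passage (quadrant w a b) 0 k = passage (quadrant w a b) 0 l + passage (shift l ?Y) (k - l) 0"
    using passage_add_0[of ?Y l "k - l"] assms by (simp add: passage_transpose)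
  have sh: "w (int i, int j) = shift l ?Y (j - l, i)" if "l < j" "0 < i" for i j
    using that by (simp add: quadrant_bulk shift_def)
  show "w (int 1, int k) + passage (quadrant w a b) 0 k \<le> passage (quadrant w a b) 0 l + passage (shift l ?Y) (k - l) 1"
    using passage_step_up[of "k - l" "shift l ?Y" 0] assms by (simp add: k sh[of k 1, simplified])
  fix i j :: nat assume ij: "1 \<le> i" "k \<le> j"
  show "w (int i, int (Suc j)) + (passage (quadrant w a b) 0 l + passage (shift l ?Y) (j - l) i) \<le> passage (quadrant w a b) 0 l + passage (shift l ?Y) (Suc j - l) i"
    using passage_step_right[of i "shift l ?Y" "j - l"] ij assms sh[of "Suc j" i] by (simp add: Suc_diff_le)
  show "w (int (Suc i), int j) + (passage (quadrant w a b) 0 l + passage (shift l ?Y) (j - l) i) \<le> passage (quadrant w a b) 0 l + passage (shift l ?Y) (j - l) (Suc i)"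
    using passage_step_up[of "j - l" "shift l ?Y" i] ij assms sh[of j "Suc i"] by simp
qed

text \<open>Backtracking along the recursion: the larger of the two predecessors is followed until
  it lies on an axis, and its position there is the exit point.\<close>

lemma passage_attained:
  "(\<exists>k\<in>{1..Suc i}. \<exists>\<pi>. up_right_path (int k, 1) (int (Suc i), int (Suc j)) \<pi> \<and>
      passage (quadrant w a b) (Suc i) (Suc j) = passage (quadrant w a b) k 0 + sum_list (map w \<pi>)) \<or>
   (\<exists>k\<in>{1..Suc j}. \<exists>\<pi>. up_right_path (1, int k) (int (Suc i), int (Suc j)) \<pi> \<and>
      passage (quadrant w a b) (Suc i) (Suc j) = passage (quadrant w a b) 0 k + sum_list (map w \<pi>))"
proof (induction "i + j" arbitrary: i j rule: less_induct)
  case less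
  have wX: "w (int (Suc i), int (Suc j)) = quadrant w a b (Suc i, Suc j)"
    by (rule quadrant_bulk) simp_all
  \<comment> \<open>Appends the site \<open>(Suc i, Suc j)\<close> to an optimal path of the chosen
    predecessor.\<close>
  have snoc: ?case
    if pre: "(\<exists>k\<in>{1..Suc i'}. \<exists>\<pi>. up_right_path (int k, 1) (int (Suc i'), int (Suc j')) \<pi> \<and>
          passage (quadrant w a b) (Suc i') (Suc j') = passage (quadrant w a b) k 0 + sum_list (map w \<pi>)) \<or>
       (\<exists>k\<in>{1..Suc j'}. \<exists>\<pi>. up_right_path (1, int k) (int (Suc i'), int (Suc j')) \<pi> \<and>
          passage (quadrant w a b) (Suc i') (Suc j') = passage (quadrant w a b) 0 k + sum_list (map w \<pi>))"
      and st: "(i = Suc i' \<and> j = j') \<or> (i = i' \<and> j = Suc j')"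
      and G: "passage (quadrant w a b) (Suc i) (Suc j) = quadrant w a b (Suc i, Suc j) + passage (quadrant w a b) (Suc i') (Suc j')" for i' j'
  proof -
    have step: "(int (Suc i), int (Suc j)) = (int (Suc i'), int (Suc j')) + (1, 0) \<or>
        (int (Suc i), int (Suc j)) = (int (Suc i'), int (Suc j')) + (0, 1)"
      using st by auto
    from pre show ?thesis
    proof
      assume "\<exists>k\<in>{1..Suc i'}. \<exists>\<pi>. up_right_path (int k, 1) (int (Suc i'), int (Suc j')) \<pi> \<and>
          passage (quadrant w a b) (Suc i') (Suc j') = passage (quadrant w a b) k 0 + sum_list (map w \<pi>)"
      then obtain k \<pi> where k: "k \<in> {1..Suc i'}" "up_right_path (int k, 1) (int (Suc i'), int (Suc j')) \<pi>"
        "passage (quadrant w a b) (Suc i') (Suc j') = passage (quadrant w a b) k 0 + sum_list (map w \<pi>)" by blast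
      have "up_right_path (int k, 1) (int (Suc i), int (Suc j)) (\<pi> @ [(int (Suc i), int (Suc j))])"
        by (rule up_right_path_snoc[OF k(2) step])
      moreover have "passage (quadrant w a b) (Suc i) (Suc j) = passage (quadrant w a b) k 0 + sum_list (map w (\<pi> @ [(int (Suc i), int (Suc j))]))"
        using G k(3) wX by simp
      moreover have "k \<in> {1..Suc i}" using k(1) st by auto
      ultimately show ?thesis by blast
    next
      assume "\<exists>k\<in>{1..Suc j'}. \<exists>\<pi>. up_right_path (1, int k) (int (Suc i'), int (Suc j')) \<pi> \<and>
          passage (quadrant w a b) (Suc i') (Suc j') = passage (quadrant w a b) 0 k + sum_list (map w \<pi>)"
      then obtain k \<pi> where k: "k \<in> {1..Suc j'}" "up_right_path (1, int k) (int (Suc i'), int (Suc j')) \<pi>"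
        "passage (quadrant w a b) (Suc i') (Suc j') = passage (quadrant w a b) 0 k + sum_list (map w \<pi>)" by blast
      have "up_right_path (1, int k) (int (Suc i), int (Suc j)) (\<pi> @ [(int (Suc i), int (Suc j))])"
        by (rule up_right_path_snoc[OF k(2) step])
      moreover have "passage (quadrant w a b) (Suc i) (Suc j) = passage (quadrant w a b) 0 k + sum_list (map w (\<pi> @ [(int (Suc i), int (Suc j))]))"
        using G k(3) wX by simp
      moreover have "k \<in> {1..Suc j}" using k(1) st by auto
      ultimately show ?thesis by blast
    qed
  qed
  show ?case
  proof (cases "passage (quadrant w a b) (Suc i) j \<le> passage (quadrant w a b) i (Suc j)")
    case True
    then have G: "passage (quadrant w a b) (Suc i) (Suc j) = quadrant w a b (Suc i, Suc j) + passage (quadrant w a b) i (Suc j)" by simp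
    show ?thesis
    proof (cases i)
      case 0
      have "up_right_path (1, int (Suc j)) (int (Suc i), int (Suc j)) [(1, int (Suc j))]"
        by (simp add: up_right_path_def 0)
      moreover have "passage (quadrant w a b) (Suc i) (Suc j) = passage (quadrant w a b) 0 (Suc j) + sum_list (map w [(1, int (Suc j))])"
        using G wX 0 by simp
      ultimately show ?thesis by (intro disjI2 bexI[of _ "Suc j"]) auto
    next
      case (Suc i')
      show ?thesis by (rule snoc[OF less.hyps[of i' j]]) (use Suc G in auto)
    qed
  next
    case False
    then have G: "passage (quadrant w a b) (Suc i) (Suc j) = quadrant w a b (Suc i, Suc j) + passage (quadrant w a b) (Suc i) j" by simp
    show ?thesis
    proof (cases j)
      case 0
      have "up_right_path (int (Suc i), 1) (int (Suc i), int (Suc j)) [(int (Suc i), 1)]"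
        by (simp add: up_right_path_def 0)
      moreover have "passage (quadrant w a b) (Suc i) (Suc j) = passage (quadrant w a b) (Suc i) 0 + sum_list (map w [(int (Suc i), 1)])"
        using G wX 0 by simp
      ultimately show ?thesis by (intro disjI1 bexI[of _ "Suc i"]) auto
    next
      case (Suc j')
      show ?thesis by (rule snoc[OF less.hyps[of i j']]) (use Suc G in auto)
    qed
  qed
qed

end

text \<open>A common bound on the path sums makes the set under \<open>Max\<close> finite, so that
  \<open>lpt\<close> is a genuine maximum.\<close>

lemma lpt_attained:
  assumes "\<And>\<pi>. up_right_path x y \<pi> \<Longrightarrow> sum_list (map w \<pi>) \<le> B" "\<exists>\<pi>. up_right_path x y \<pi>"
  shows "\<exists>\<pi>. up_right_path x y \<pi> \<and> lpt w x y = sum_list (map w \<pi>)"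
    and "up_right_path x y \<pi> \<Longrightarrow> sum_list (map w \<pi>) \<le> lpt w x y"
proof -
  let ?S = "{sum_list (map w \<pi>) | \<pi>. up_right_path x y \<pi>}"
  have fin: "finite ?S" by (rule finite_subset[of _ "{..B}"]) (use assms(1) in auto)
  have "Max ?S \<in> ?S" by (rule Max_in[OF fin]) (use assms(2) in auto)
  then show "\<exists>\<pi>. up_right_path x y \<pi> \<and> lpt w x y = sum_list (map w \<pi>)"
    by (auto simp: lpt_def)
  show "up_right_path x y \<pi> \<Longrightarrow> sum_list (map w \<pi>) \<le> lpt w x y"
    unfolding lpt_def by (rule Max_ge[OF fin]) auto
qed

lemma sum_int_Suc: "(\<Sum>i=1..int (Suc k). f i) = (\<Sum>i=1..int k. f i) + f (int (Suc k))"
proof -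
  have "{1..int (Suc k)} = insert (int (Suc k)) {1..int k}" by auto
  then show ?thesis by (simp add: add.commute)
qed

context
  fixes w a b :: "int \<times> int \<Rightarrow> nat" and m n :: nat
  assumes mn: "0 < m" "0 < n"
begin

lemma passage_quadrant_axes: "passage (quadrant w a b) k 0 = (\<Sum>i=1..int k. a (i, 0))" "passage (quadrant w a b) 0 k = (\<Sum>j=1..int k. b (0, j))"
proof -
  show "passage (quadrant w a b) k 0 = (\<Sum>i=1..int k. a (i, 0))"
    by (induction k) (simp_all only: passage.simps sum_int_Suc, simp_all add: quadrant_def)
  show "passage (quadrant w a b) 0 k = (\<Sum>j=1..int k. b (0, j))"
    by (induction k) (simp_all only: passage.simps sum_int_Suc, simp_all add: quadrant_def)
qed

lemma horizontal_exit_path_le: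
  assumes "up_right_path (int k, 1) (int m, int n) \<pi>" "0 < k" "k \<le> m"
  shows "passage (quadrant w a b) k 0 + sum_list (map w \<pi>) \<le> passage (quadrant w a b) m n"
  using horizontal_exit_le[OF assms(1), where l = 0 and w = w and a = a and b = b]
    passage_shift_le[of "quadrant w a b" 0 m n] assms by simp

lemma vertical_exit_path_le:
  assumes "up_right_path (1, int k) (int m, int n) \<pi>" "0 < k" "k \<le> n"
  shows "passage (quadrant w a b) 0 k + sum_list (map w \<pi>) \<le> passage (quadrant w a b) m n"
proof (rule path_sum_le[where g = "passage (quadrant w a b)"])
  show "up_right_path (int 1, int k) (int m, int n) \<pi>" using assms by simp
  show "w (int 1, int k) + passage (quadrant w a b) 0 k \<le> passage (quadrant w a b) 1 k"
    using passage_step_right[of k "quadrant w a b" 0] assms by (simp add: quadrant_bulk[of 1 k w a b, simplified])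
  fix i j :: nat assume ij: "1 \<le> i" "k \<le> j"
  show "w (int (Suc i), int j) + passage (quadrant w a b) i j \<le> passage (quadrant w a b) (Suc i) j"
    using passage_step_right[of j "quadrant w a b" i] ij assms quadrant_bulk[of "Suc i" j w a b] by simp
  show "w (int i, int (Suc j)) + passage (quadrant w a b) i j \<le> passage (quadrant w a b) i (Suc j)"
    using passage_step_up[of i "quadrant w a b" j] ij assms quadrant_bulk[of i "Suc j" w a b] by simp
qed

lemma exit_val1_attained:
  assumes "0 < k" "k \<le> m"
  shows "\<exists>\<pi>. up_right_path (int k, 1) (int m, int n) \<pi> \<and>
      exit_val1 w a (int m) (int n) (int k) = passage (quadrant w a b) k 0 + sum_list (map w \<pi>)"
    and "up_right_path (int k, 1) (int m, int n) \<pi> \<Longrightarrow>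
      passage (quadrant w a b) k 0 + sum_list (map w \<pi>) \<le> exit_val1 w a (int m) (int n) (int k)"
proof -
  have B: "sum_list (map w \<pi>) \<le> passage (quadrant w a b) m n" if "up_right_path (int k, 1) (int m, int n) \<pi>" for \<pi>
    using horizontal_exit_path_le[OF that] assms by simp
  have ex: "\<exists>\<pi>. up_right_path (int k, 1) (int m, int n) \<pi>"
    using up_right_path_exists[of "int k" 1 "m - k" "n - 1"] assms mn by (simp add: of_nat_diff)
  show "\<exists>\<pi>. up_right_path (int k, 1) (int m, int n) \<pi> \<and>
      exit_val1 w a (int m) (int n) (int k) = passage (quadrant w a b) k 0 + sum_list (map w \<pi>)"
    using lpt_attained(1)[OF B ex] by (auto simp: exit_val1_def passage_quadrant_axes)
  show "up_right_path (int k, 1) (int m, int n) \<pi> \<Longrightarrow>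
      passage (quadrant w a b) k 0 + sum_list (map w \<pi>) \<le> exit_val1 w a (int m) (int n) (int k)"
    using lpt_attained(2)[OF B ex] by (auto simp: exit_val1_def passage_quadrant_axes)
qed

lemma exit_val2_attained:
  assumes "0 < k" "k \<le> n"
  shows "\<exists>\<pi>. up_right_path (1, int k) (int m, int n) \<pi> \<and>
      exit_val2 w b (int m) (int n) (int k) = passage (quadrant w a b) 0 k + sum_list (map w \<pi>)"
    and "up_right_path (1, int k) (int m, int n) \<pi> \<Longrightarrow>
      passage (quadrant w a b) 0 k + sum_list (map w \<pi>) \<le> exit_val2 w b (int m) (int n) (int k)"
proof -
  have B: "sum_list (map w \<pi>) \<le> passage (quadrant w a b) m n" if "up_right_path (1, int k) (int m, int n) \<pi>" for \<pi>
    using vertical_exit_path_le[OF that] assms by simp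
  have ex: "\<exists>\<pi>. up_right_path (1, int k) (int m, int n) \<pi>"
    using up_right_path_exists[of 1 "int k" "m - 1" "n - k"] assms mn by (simp add: of_nat_diff)
  show "\<exists>\<pi>. up_right_path (1, int k) (int m, int n) \<pi> \<and>
      exit_val2 w b (int m) (int n) (int k) = passage (quadrant w a b) 0 k + sum_list (map w \<pi>)"
    using lpt_attained(1)[OF B ex] by (auto simp: exit_val2_def passage_quadrant_axes)
  show "up_right_path (1, int k) (int m, int n) \<pi> \<Longrightarrow>
      passage (quadrant w a b) 0 k + sum_list (map w \<pi>) \<le> exit_val2 w b (int m) (int n) (int k)"
    using lpt_attained(2)[OF B ex] by (auto simp: exit_val2_def passage_quadrant_axes)
qed

lemma exit_val_le_passage:
  "k \<in> {1..int m} \<Longrightarrow> exit_val1 w a (int m) (int n) k \<le> passage (quadrant w a b) m n"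
  "k \<in> {1..int n} \<Longrightarrow> exit_val2 w b (int m) (int n) k \<le> passage (quadrant w a b) m n"
proof -
  assume "k \<in> {1..int m}"
  then obtain i where i: "k = int i" "0 < i" "i \<le> m" by (cases k) auto
  then show "exit_val1 w a (int m) (int n) k \<le> passage (quadrant w a b) m n"
    using exit_val1_attained(1)[OF i(2,3)] horizontal_exit_path_le[OF _ i(2,3)] by auto
next
  assume "k \<in> {1..int n}"
  then obtain i where i: "k = int i" "0 < i" "i \<le> n" by (cases k) auto
  then show "exit_val2 w b (int m) (int n) k \<le> passage (quadrant w a b) m n"
    using exit_val2_attained(1)[OF i(2,3)] vertical_exit_path_le[OF _ i(2,3)] by auto
qed

lemma passage_attained_by_exit:
  "(\<exists>k\<in>{1..int m}. exit_val1 w a (int m) (int n) k = passage (quadrant w a b) m n) \<or>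
   (\<exists>k\<in>{1..int n}. exit_val2 w b (int m) (int n) k = passage (quadrant w a b) m n)"
proof -
  obtain i j where ij: "m = Suc i" "n = Suc j" using mn by (metis gr0_implies_Suc)
  from passage_attained[of i j w a b, folded ij] show ?thesis
  proof (elim disjE bexE exE conjE)
    fix k \<pi> assume k: "k \<in> {1..m}" "up_right_path (int k, 1) (int m, int n) \<pi>"
      "passage (quadrant w a b) m n = passage (quadrant w a b) k 0 + sum_list (map w \<pi>)"
    then have "exit_val1 w a (int m) (int n) (int k) = passage (quadrant w a b) m n"
      using exit_val1_attained(2)[of k \<pi>] exit_val_le_passage(1)[of "int k"] by auto
    then show ?thesis using k(1) by (intro disjI1 bexI[of _ "int k"]) auto
  next
    fix k \<pi> assume k: "k \<in> {1..n}" "up_right_path (1, int k) (int m, int n) \<pi>"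
      "passage (quadrant w a b) m n = passage (quadrant w a b) 0 k + sum_list (map w \<pi>)"
    then have "exit_val2 w b (int m) (int n) (int k) = passage (quadrant w a b) m n"
      using exit_val2_attained(2)[of k \<pi>] exit_val_le_passage(2)[of "int k"] by auto
    then show ?thesis using k(1) by (intro disjI2 bexI[of _ "int k"]) auto
  qed
qed

lemma lpt_stat_eq_passage: "lpt_stat w a b (int m) (int n) = passage (quadrant w a b) m n"
proof (rule antisym)
  show "lpt_stat w a b (int m) (int n) \<le> passage (quadrant w a b) m n"
    unfolding lpt_stat_def using mn exit_val_le_passage by auto
  show "passage (quadrant w a b) m n \<le> lpt_stat w a b (int m) (int n)"
    using passage_attained_by_exit unfolding lpt_stat_def
    by (metis (no_types, lifting) Max_ge finite_atLeastAtMost_int finite_imageI imageI max.coboundedI1 max.coboundedI2)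
qed

lemma finite_Exit: "finite (Exit w a b (int m) (int n))"
  by (rule finite_subset[of _ "{- int n..int m}"]) (auto simp: Exit_def)

lemma Exit_nonempty: "Exit w a b (int m) (int n) \<noteq> {}"
  using passage_attained_by_exit by (auto simp: Exit_def lpt_stat_eq_passage)

text \<open>An element of \<open>Exit\<close> above \<open>int l\<close> is positive, hence an index
  of the first family, and an optimal path for it leaves the axis after
  \<open>(l, 0)\<close>.\<close>

lemma exits_after_if_less_Z1:
  assumes "int l < Z1 w a b (int m) (int n)"
  shows "exits_after (quadrant w a b) m n l"
proof -
  have "Z1 w a b (int m) (int n) \<in> Exit w a b (int m) (int n)"
    unfolding Z1_def by (rule Max_in[OF finite_Exit Exit_nonempty])
  then obtain k where k: "int l < k" "k \<in> {1..int m}" "exit_val1 w a (int m) (int n) k = passage (quadrant w a b) m n"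
    using assms by (auto simp: Exit_def lpt_stat_eq_passage)
  then obtain i where i: "k = int i" "0 < i" "i \<le> m" "l < i" by (cases k) auto
  then obtain \<pi> where "up_right_path (int i, 1) (int m, int n) \<pi>" "passage (quadrant w a b) m n = passage (quadrant w a b) i 0 + sum_list (map w \<pi>)"
    using exit_val1_attained(1)[OF i(2,3)] k(3) by auto
  then show ?thesis
    using horizontal_exit_le[of i m n \<pi> l w a b] i by (simp add: exits_after_def)
qed

text \<open>The reflected counterpart, with \<open>m\<close> and \<open>n\<close> exchanged, so that
  one tail bound serves both axes.\<close>

lemma exits_after_if_Z2_less:
  assumes "Z2 w a b (int m) (int n) < - int l"
  shows "exits_after (quadrant w a b \<circ> prod.swap) n m l"
proof -
  have "Z2 w a b (int m) (int n) \<in> Exit w a b (int m) (int n)"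
    unfolding Z2_def by (rule Min_in[OF finite_Exit Exit_nonempty])
  then obtain k where k: "int l < k" "k \<in> {1..int n}" "exit_val2 w b (int m) (int n) k = passage (quadrant w a b) m n"
    using assms by (auto simp: Exit_def lpt_stat_eq_passage)
  then obtain i where i: "k = int i" "0 < i" "i \<le> n" "l < i" by (cases k) auto
  then obtain \<pi> where "up_right_path (1, int i) (int m, int n) \<pi>" "passage (quadrant w a b) m n = passage (quadrant w a b) 0 i + sum_list (map w \<pi>)"
    using exit_val2_attained(1)[OF i(2,3)] k(3) by auto
  then show ?thesis
    using vertical_exit_le[of i m n \<pi> l w a b] i by (simp add: exits_after_def passage_transpose)
qed

lemma Z2_le_Z1: "Z2 w a b (int m) (int n) \<le> Z1 w a b (int m) (int n)"
  unfolding Z1_def Z2_def using finite_Exit Exit_nonempty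
  by (meson Max_ge Min_in Min_le)

end

section \<open>The law of the weights on the probability space\<close>

lemma countable_finitely_supported:
  assumes "finite A"
  shows "countable {f :: 'b \<Rightarrow> nat. \<forall>v. v \<notin> A \<longrightarrow> f v = 0}"
proof -
  have "countable (Pi\<^sub>E A (\<lambda>_. UNIV :: nat set))" by (intro countable_PiE assms) auto
  then have "countable ((\<lambda>h v. if v \<in> A then h v else 0) ` (Pi\<^sub>E A (\<lambda>_. UNIV :: nat set)))"
    by (rule countable_image)
  then show ?thesis
    unfolding dflt_image_PiE by (rule countable_subset[rotated]) (auto simp: PiE_dflt_def)
qed

text \<open>\<open>R\<close> vanishes off the finite set \<open>A\<close>, so it takes values in a
  countable set. Its law is then determined by the masses of points, which factorize by
  independence.\<close>

lemma (in prob_space) distr_eq_Pi_pmf: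
  fixes Y :: "'i \<Rightarrow> 'a \<Rightarrow> nat" and h :: "'b \<Rightarrow> 'i"
  assumes ind: "indep_vars (\<lambda>_. count_space UNIV) Y K"
    and A: "finite A" "A \<noteq> {}" and h: "inj_on h A" "h ` A \<subseteq> K"
    and D: "\<And>v. v \<in> A \<Longrightarrow> distr M (count_space UNIV) (Y (h v)) = measure_pmf (D v)"
  defines "R \<equiv> \<lambda>x v. if v \<in> A then Y (h v) x else 0"
  shows "R \<in> measurable M (count_space UNIV)"
    and "distr M (count_space UNIV) R = measure_pmf (Pi_pmf A 0 D)"
proof -
  define C where "C = {f :: 'b \<Rightarrow> nat. \<forall>v. v \<notin> A \<longrightarrow> f v = 0}"
  have C: "countable C" unfolding C_def by (rule countable_finitely_supported[OF A(1)])
  have Y: "Y (h v) \<in> measurable M (count_space UNIV)" if "v \<in> A" for v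
    using ind h that by (auto simp: indep_vars_def)
  have vim: "R -` {f} \<inter> space M = (\<Inter>v\<in>A. Y (h v) -` {f v} \<inter> space M)" if "f \<in> C" for f
    using that A(2) by (auto simp: R_def C_def fun_eq_iff)
  have ms: "R -` {f} \<inter> space M \<in> sets M" if "f \<in> C" for f
    unfolding vim[OF that] using A by (intro sets.finite_INT measurable_sets[OF Y]) auto
  \<comment> \<open>On the countable set \<open>C\<close> it suffices that preimages of points are
    measurable.\<close>
  have RC: "R \<in> measurable M (count_space C)"
    unfolding measurable_count_space_eq_countable[OF C] using ms by (auto simp: R_def C_def)
  show R: "R \<in> measurable M (count_space UNIV)"
    by (rule measurable_compose[OF RC]) simp
  show "distr M (count_space UNIV) R = measure_pmf (Pi_pmf A 0 D)"
  proof (rule measure_eqI_countable_AE[where \<Omega> = C])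
    show "AE f in distr M (count_space UNIV) R. f \<in> C"
      by (subst AE_distr_iff[OF R]) (auto simp: R_def C_def)
    show "AE f in measure_pmf (Pi_pmf A 0 D). f \<in> C"
      using set_Pi_pmf_subset[OF A(1), of 0 D] by (auto simp: AE_measure_pmf_iff C_def)
    fix f assume f: "f \<in> C"
    have "emeasure (distr M (count_space UNIV) R) {f} = ennreal (prob (R -` {f} \<inter> space M))"
      by (subst emeasure_distr[OF R]) (auto simp: emeasure_eq_measure)
    also have "R -` {f} \<inter> space M = (\<Inter>u\<in>h ` A. Y u -` {f (inv_into A h u)} \<inter> space M)"
      unfolding vim[OF f] using h by simp
    also have "prob \<dots> = (\<Prod>u\<in>h ` A. prob (Y u -` {f (inv_into A h u)} \<inter> space M))"
      using indep_varsD_finite[OF indep_vars_subset[OF ind h(2)], of "\<lambda>u. {f (inv_into A h u)}"] A by simp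
    also have "\<dots> = (\<Prod>v\<in>A. prob (Y (h v) -` {f v} \<inter> space M))"
      using h by (simp add: prod.reindex)
    also have "\<dots> = (\<Prod>v\<in>A. pmf (D v) (f v))"
    proof (intro prod.cong refl)
      fix v assume v: "v \<in> A"
      have "prob (Y (h v) -` {f v} \<inter> space M) = measure (distr M (count_space UNIV) (Y (h v))) {f v}"
        by (rule measure_distr[OF Y[OF v], symmetric]) simp
      also have "\<dots> = pmf (D v) (f v)" by (simp add: D[OF v] measure_pmf_single)
      finally show "prob (Y (h v) -` {f v} \<inter> space M) = pmf (D v) (f v)" .
    qed
    also have "ennreal \<dots> = emeasure (measure_pmf (Pi_pmf A 0 D)) {f}"
      using f A by (simp add: emeasure_pmf_single pmf_Pi C_def)
    finally show "emeasure (distr M (count_space UNIV) R) {f} = emeasure (measure_pmf (Pi_pmf A 0 D)) {f}" .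
  qed (use C in auto)
qed

lemma exits_after_cong:
  assumes "\<And>v. v \<in> sites m n \<Longrightarrow> X v = Y v"
  shows "exits_after X m n l \<longleftrightarrow> exits_after Y m n l"
proof (cases "l < m")
  case True
  have "passage X m n = passage Y m n" "passage X l 0 = passage Y l 0" "passage (shift l X) (m - l) n = passage (shift l Y) (m - l) n"
    by (rule passage_cong; use assms True in \<open>force simp: sites_def shift_def\<close>)+
  then show ?thesis by (simp add: exits_after_def)
qed (simp add: exits_after_def)

lemma prob_exits_after_transpose:
  "measure_pmf.prob (lpp_pmf r \<alpha> \<beta> m n) {X. exits_after (X \<circ> prod.swap) n m l} =
   measure_pmf.prob (lpp_pmf r \<beta> \<alpha> n m) {X. exits_after X n m l}"
proof -
  let ?q = "\<lambda>X v. if v \<in> sites n m then X (prod.swap v) else (0::nat)"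
  have "map_pmf ?q (lpp_pmf r \<alpha> \<beta> m n) = Pi_pmf (sites n m) 0 (\<lambda>v. site_law r \<alpha> \<beta> (prod.swap v))"
    unfolding lpp_pmf_def by (intro Pi_pmf_reindex) (auto simp: sites_def)
  also have "\<dots> = lpp_pmf r \<beta> \<alpha> n m"
    unfolding lpp_pmf_def by (intro Pi_pmf_cong) (auto simp: sites_def site_law_def)
  finally have "lpp_pmf r \<beta> \<alpha> n m = map_pmf ?q (lpp_pmf r \<alpha> \<beta> m n)" ..
  moreover have "exits_after (?q X) n m l \<longleftrightarrow> exits_after (X \<circ> prod.swap) n m l" for X
    by (rule exits_after_cong) simp
  ultimately show ?thesis by (simp add: vimage_def)
qed

text \<open>An event that depends only on the finitely many weights at \<open>sites m n\<close> is
  measurable and can be evaluated under their product law.\<close>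

lemma (in stationary_lpp) prob_quadrant_event:
  fixes m n :: nat
  assumes mn: "0 < m" and cong: "\<And>X Y. (\<And>v. v \<in> sites m n \<Longrightarrow> X v = Y v) \<Longrightarrow> Q X \<longleftrightarrow> Q Y"
  defines "E \<equiv> {x \<in> space M. Q (quadrant (\<lambda>v. \<omega> v x) (\<lambda>v. I v x) (\<lambda>v. J v x))}"
  shows "E \<in> sets M" and "prob E = measure_pmf.prob (lpp_pmf r (pbar r \<xi>) (r / pbar r \<xi>) m n) {X. Q X}"
proof -
  let ?h = "\<lambda>v. (int (fst v), int (snd v))"
  define R where "R = (\<lambda>x v. if v \<in> sites m n then quadrant_weight \<omega> I J (?h v) x else 0)"
  have "(m, 0) \<in> sites m n" using mn by (simp add: sites_def)
  then have ne: "sites m n \<noteq> {}" by blast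
  have h: "inj_on ?h (sites m n)" "?h ` sites m n \<subseteq> {0..} \<times> {0..} - {(0, 0)}"
    by (auto simp: inj_on_def sites_def)
  have law: "distr M (count_space UNIV) (quadrant_weight \<omega> I J (?h v)) =
      measure_pmf (site_law r (pbar r \<xi>) (r / pbar r \<xi>) v)" if "v \<in> sites m n" for v
  proof -
    have "quadrant_weight \<omega> I J (?h v) =
        (if snd v = 0 then I (int (fst v), 0) else if fst v = 0 then J (0, int (snd v)) else \<omega> (?h v))"
      by (auto simp: quadrant_weight_def fun_eq_iff)
    then show ?thesis
      using that bulk_law[of "?h v"] I_law[of "int (fst v)"] J_law[of "int (snd v)"]
      by (cases v) (auto simp: site_law_def sites_def)
  qed
  have R: "R \<in> measurable M (count_space UNIV)"
    "distr M (count_space UNIV) R = measure_pmf (Pi_pmf (sites m n) 0 (site_law r (pbar r \<xi>) (r / pbar r \<xi>)))"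
    unfolding R_def by (rule distr_eq_Pi_pmf[OF indep finite_sites ne h law]; assumption)+
  have "Q (R x) \<longleftrightarrow> Q (quadrant (\<lambda>v. \<omega> v x) (\<lambda>v. I v x) (\<lambda>v. J v x))" for x
    by (rule cong) (auto simp: R_def quadrant_def quadrant_weight_def Let_def)
  then have E: "E = R -` {X. Q X} \<inter> space M" by (auto simp: E_def)
  show "E \<in> sets M" unfolding E by (rule measurable_sets[OF R(1)]) simp
  show "prob E = measure_pmf.prob (lpp_pmf r (pbar r \<xi>) (r / pbar r \<xi>) m n) {X. Q X}"
    unfolding E lpp_pmf_def R(2)[symmetric] by (rule measure_distr[OF R(1), symmetric]) simp
qed

lemma (in stationary_lpp) prob_exit_point_le:
  fixes m n l :: nat
  assumes mn: "0 < m" "0 < n" and l: "real l < y"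
  shows "prob {x \<in> space M.
      max \<bar>real_of_int (Z1 (\<lambda>v. \<omega> v x) (\<lambda>v. I v x) (\<lambda>v. J v x) (int m) (int n))\<bar>
          \<bar>real_of_int (Z2 (\<lambda>v. \<omega> v x) (\<lambda>v. I v x) (\<lambda>v. J v x) (int m) (int n))\<bar> \<ge> y} \<le>
    measure_pmf.prob (lpp_pmf r (pbar r \<xi>) (r / pbar r \<xi>) m n) {X. exits_after X m n l} +
    measure_pmf.prob (lpp_pmf r (r / pbar r \<xi>) (pbar r \<xi>) n m) {X. exits_after X n m l}"
    (is "prob ?Z \<le> _")
proof -
  let ?X = "\<lambda>x. quadrant (\<lambda>v. \<omega> v x) (\<lambda>v. I v x) (\<lambda>v. J v x)"
  let ?E1 = "{x \<in> space M. exits_after (?X x) m n l}"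
  let ?E2 = "{x \<in> space M. exits_after (?X x \<circ> prod.swap) n m l}"
  note E1 = prob_quadrant_event[where m = m and n = n and Q = "\<lambda>X. exits_after X m n l", OF mn(1) exits_after_cong]
  have cong2: "exits_after (X \<circ> prod.swap) n m l \<longleftrightarrow> exits_after (Y \<circ> prod.swap) n m l"
    if "\<And>v. v \<in> sites m n \<Longrightarrow> X v = Y v" for X Y
    by (rule exits_after_cong) (auto simp: sites_def intro!: that)
  note E2 = prob_quadrant_event[where m = m and n = n and Q = "\<lambda>X. exits_after (X \<circ> prod.swap) n m l", OF mn(1) cong2]
  have "?Z \<subseteq> ?E1 \<union> ?E2"
  proof
    fix x assume x: "x \<in> ?Z"
    let ?Z1 = "Z1 (\<lambda>v. \<omega> v x) (\<lambda>v. I v x) (\<lambda>v. J v x) (int m) (int n)"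
    let ?Z2 = "Z2 (\<lambda>v. \<omega> v x) (\<lambda>v. I v x) (\<lambda>v. J v x) (int m) (int n)"
    \<comment> \<open>A large \<open>\<bar>?Z1\<bar>\<close> with \<open>?Z1\<close> negative passes
      to \<open>?Z2\<close> by this inequality, and likewise a large positive \<open>?Z2\<close>
      passes to \<open>?Z1\<close>.\<close>
    have "?Z2 \<le> ?Z1" by (rule Z2_le_Z1[OF mn])
    then have "real_of_int ?Z2 \<le> real_of_int ?Z1" by simp
    with x l have "real l < real_of_int ?Z1 \<or> real_of_int ?Z2 < - real l" by auto
    then have "int l < ?Z1 \<or> ?Z2 < - int l" by linarith
    then show "x \<in> ?E1 \<union> ?E2"
      using x exits_after_if_less_Z1[OF mn] exits_after_if_Z2_less[OF mn] by auto
  qed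
  then have "prob ?Z \<le> prob (?E1 \<union> ?E2)"
    using E1(1) E2(1) by (intro finite_measure_mono) auto
  also have "\<dots> \<le> prob ?E1 + prob ?E2"
    using E1(1) E2(1) by (intro measure_Un_le) auto
  finally show ?thesis
    by (simp add: E1(2) E2(2) prob_exits_after_transpose)
qed
section \<open>The characteristic parameter\<close>

text \<open>The value of \<open>(p - r) / (1 - p)\<close> at the characteristic parameter
  \<open>p\<close> of the direction \<open>(x, 1 - x)\<close>.\<close>

definition slope_root :: "real \<Rightarrow> real \<Rightarrow> real" where
  "slope_root r x = sqrt (r * (1 - x) / x)"

lemma pbar_eq_slope_root:
  assumes "0 < r" "0 < x" "x < 1"
  shows "pbar r (x, 1 - x) = (r + slope_root r x) / (1 + slope_root r x)"
proof -
  define \<rho> where "\<rho> = slope_root r x"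
  have \<rho>: "0 < \<rho>" "x * \<rho>\<^sup>2 = r * (1 - x)" using assms by (auto simp: \<rho>_def slope_root_def)
  have "sqrt (r * x * (1 - x)) = sqrt ((x * \<rho>)\<^sup>2)"
    using \<rho>(2) by (simp add: power2_eq_square mult_ac)
  then have s: "sqrt (r * x * (1 - x)) = x * \<rho>" using assms \<rho> by simp
  have "r * (x + (1 - x)) + (r + 1) * (x * \<rho>) = x * ((1 + \<rho>) * (r + \<rho>))"
    using \<rho>(2) by (simp add: power2_eq_square algebra_simps)
  moreover have "x + r * (1 - x) + 2 * (x * \<rho>) = x * ((1 + \<rho>) * (1 + \<rho>))"
    using \<rho>(2) by (simp add: power2_eq_square algebra_simps)
  ultimately have "pbar r (x, 1 - x) = (x * ((1 + \<rho>) * (r + \<rho>))) / (x * ((1 + \<rho>) * (1 + \<rho>)))"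
    by (simp add: pbar_def s)
  also have "\<dots> = (r + \<rho>) / (1 + \<rho>)" using assms \<rho> by simp
  finally show ?thesis by (simp add: \<rho>_def)
qed

text \<open>For \<open>x = m / (m + n)\<close>, multiplication by \<open>m + n\<close> gives the
  hypothesis \<open>eq\<close> of \<open>drift_diff\<close>.\<close>

lemma pbar_critical:
  assumes "0 < r" "0 < x" "x < 1"
  shows "x * (pbar r (x, 1 - x) - r)\<^sup>2 = (1 - x) * r * (1 - pbar r (x, 1 - x))\<^sup>2"
proof -
  define \<rho> where "\<rho> = slope_root r x"
  have \<rho>: "0 < \<rho>" "x * \<rho>\<^sup>2 = r * (1 - x)" using assms by (auto simp: \<rho>_def slope_root_def)
  have p: "pbar r (x, 1 - x) = (r + \<rho>) / (1 + \<rho>)"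
    using pbar_eq_slope_root[OF assms] by (simp add: \<rho>_def)
  have 1: "pbar r (x, 1 - x) - r = \<rho> * ((1 - r) / (1 + \<rho>))" "1 - pbar r (x, 1 - x) = (1 - r) / (1 + \<rho>)"
    using \<rho> by (simp_all add: p field_simps)
  show ?thesis unfolding 1 power_mult_distrib using \<rho>(2) by (simp add: mult_ac)
qed

text \<open>\<open>pbar\<close> is \<open>1 - (1 - r) / (1 + \<rho>)\<close> with
  \<open>\<rho> = slope_root r x\<close>, which stays between two positive constants. The square of
  \<rho> is rational in \<open>x\<close> with an explicit difference; dividing by the sum of two
  roots, at least \<rho>0, gives the Lipschitz bound.\<close>

lemma pbar_bounds:
  assumes r: "0 < r" "r < 1" and d: "0 < d" "d < 1"
  obtains \<tau> \<Lambda> where "0 < \<tau>" "\<tau> \<le> 1" "0 < \<Lambda>"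
    "\<And>x. d \<le> x \<Longrightarrow> x \<le> 1 - d \<Longrightarrow> r + \<tau> \<le> pbar r (x, 1 - x) \<and> pbar r (x, 1 - x) \<le> 1 - \<tau>"
    "\<And>x y. d \<le> x \<Longrightarrow> x \<le> 1 - d \<Longrightarrow> d \<le> y \<Longrightarrow> y \<le> 1 - d \<Longrightarrow>
      \<bar>pbar r (x, 1 - x) - pbar r (y, 1 - y)\<bar> \<le> \<Lambda> * \<bar>x - y\<bar>"
proof -
  define \<rho>0 \<rho>1 where "\<rho>0 = sqrt (r * d)" and "\<rho>1 = sqrt (r / d)"
  have "r * d \<le> 1" using mult_mono[of r 1 d 1] r d by simp
  then have \<rho>0: "0 < \<rho>0" "\<rho>0 \<le> 1" using r d by (auto simp: \<rho>0_def)
  have \<rho>1: "0 < \<rho>1" using r d by (simp add: \<rho>1_def)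
  have sr: "\<rho>0 \<le> slope_root r x" "slope_root r x \<le> \<rho>1" if x: "d \<le> x" "x \<le> 1 - d" for x
  proof -
    have "d * x \<le> d * 1" using x d by (intro mult_left_mono) auto
    then have "d * x \<le> 1 - x" using x by linarith
    then have "d \<le> (1 - x) / x" using x d by (simp add: pos_le_divide_eq)
    then have "r * d \<le> r * ((1 - x) / x)" using r by (intro mult_left_mono) auto
    then show "\<rho>0 \<le> slope_root r x" by (simp add: \<rho>0_def slope_root_def)
    have "r * (1 - x) \<le> r * 1" using x d r by (intro mult_left_mono) auto
    then have "r * (1 - x) / x \<le> r / d" using x d r by (intro frac_le) auto
    then show "slope_root r x \<le> \<rho>1" by (simp add: \<rho>1_def slope_root_def)
  qed
  define \<tau> where "\<tau> = (1 - r) * (\<rho>0 / (1 + \<rho>1))"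
  define \<Lambda> where "\<Lambda> = 1 / (\<rho>0 * d\<^sup>2)"
  have p: "pbar r (x, 1 - x) = 1 - (1 - r) / (1 + slope_root r x)" "0 < slope_root r x"
    if x: "d \<le> x" "x \<le> 1 - d" for x
  proof -
    show s: "0 < slope_root r x" using sr[OF x] \<rho>0 by simp
    show "pbar r (x, 1 - x) = 1 - (1 - r) / (1 + slope_root r x)"
      using r d x s by (subst pbar_eq_slope_root) (auto simp: field_simps)
  qed
  show ?thesis
  proof
    show "0 < \<tau>" using r \<rho>0 \<rho>1 by (simp add: \<tau>_def)
    have "(1 - r) * (\<rho>0 / (1 + \<rho>1)) \<le> 1 * 1"
      using r \<rho>0 \<rho>1 by (intro mult_mono) auto
    then show "\<tau> \<le> 1" by (simp add: \<tau>_def)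
    show "0 < \<Lambda>" using \<rho>0 d by (simp add: \<Lambda>_def)
    fix x assume x: "d \<le> x" "x \<le> 1 - d"
    let ?\<rho> = "slope_root r x"
    have "\<tau> \<le> (1 - r) * (1 / (1 + ?\<rho>))"
      unfolding \<tau>_def using r \<rho>0 \<rho>1 sr[OF x] p(2)[OF x] by (intro mult_left_mono frac_le) auto
    moreover have "\<tau> \<le> (1 - r) * (?\<rho> / (1 + ?\<rho>))"
      unfolding \<tau>_def using r \<rho>0 \<rho>1 sr[OF x] p(2)[OF x] by (intro mult_left_mono frac_le) auto
    moreover have "(1 - r) * (?\<rho> / (1 + ?\<rho>)) = 1 - r - (1 - r) / (1 + ?\<rho>)"
      using p(2)[OF x] by (simp add: field_simps)
    ultimately show "r + \<tau> \<le> pbar r (x, 1 - x) \<and> pbar r (x, 1 - x) \<le> 1 - \<tau>"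
      by (simp add: p(1)[OF x])
    fix y assume y: "d \<le> y" "y \<le> 1 - d"
    let ?\<rho>' = "slope_root r y"
    have "pbar r (x, 1 - x) - pbar r (y, 1 - y) = (1 - r) * (?\<rho> - ?\<rho>') / ((1 + ?\<rho>) * (1 + ?\<rho>'))"
      using p(2)[OF x] p(2)[OF y] by (simp add: p(1)[OF x] p(1)[OF y] field_simps)
    then have "\<bar>pbar r (x, 1 - x) - pbar r (y, 1 - y)\<bar> = (1 - r) * \<bar>?\<rho> - ?\<rho>'\<bar> / ((1 + ?\<rho>) * (1 + ?\<rho>'))"
      using r p(2)[OF x] p(2)[OF y] by (simp add: abs_mult)
    also have "\<dots> \<le> 1 * \<bar>?\<rho> - ?\<rho>'\<bar> / (1 * 1)"
      using r p(2)[OF x] p(2)[OF y] by (intro frac_le mult_mono) auto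
    also have "\<dots> \<le> \<Lambda> * \<bar>x - y\<bar>"
    proof -
      have "?\<rho>\<^sup>2 - ?\<rho>'\<^sup>2 = r * (1 - x) / x - r * (1 - y) / y"
        using r d x y by (simp add: slope_root_def)
      also have "\<dots> = r * (y - x) / (x * y)" using d x y by (simp add: field_simps)
      finally have "(?\<rho> - ?\<rho>') * (?\<rho> + ?\<rho>') = r * (y - x) / (x * y)"
        by (simp add: power2_eq_square algebra_simps)
      then have "\<bar>?\<rho> - ?\<rho>'\<bar> * \<bar>?\<rho> + ?\<rho>'\<bar> = \<bar>r * (y - x) / (x * y)\<bar>"
        by (simp only: abs_mult[symmetric])
      also have "\<dots> = r * \<bar>x - y\<bar> / (x * y)" using r d x y by (simp add: abs_mult abs_minus_commute)
      also have "\<dots> \<le> 1 * \<bar>x - y\<bar> / (d * d)"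
        using r d x y by (intro frac_le mult_mono) auto
      finally have "\<bar>?\<rho> - ?\<rho>'\<bar> * \<bar>?\<rho> + ?\<rho>'\<bar> \<le> \<bar>x - y\<bar> / d\<^sup>2" by (simp add: power2_eq_square)
      moreover have "\<bar>?\<rho> - ?\<rho>'\<bar> * \<rho>0 \<le> \<bar>?\<rho> - ?\<rho>'\<bar> * \<bar>?\<rho> + ?\<rho>'\<bar>"
        using sr(1)[OF x] p(2)[OF y] \<rho>0 by (intro mult_left_mono) auto
      ultimately have "\<bar>?\<rho> - ?\<rho>'\<bar> * \<rho>0 \<le> \<bar>x - y\<bar> / d\<^sup>2" by linarith
      then show ?thesis using \<rho>0 d by (simp add: \<Lambda>_def field_simps)
    qed
    finally show "\<bar>pbar r (x, 1 - x) - pbar r (y, 1 - y)\<bar> \<le> \<Lambda> * \<bar>x - y\<bar>" .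
  qed
qed

section \<open>Choice of the constants and rescaling\<close>

theorem theoremB1:
  fixes r \<delta> :: real
  assumes "0 < r" "r < 1" "0 < \<delta>" "\<delta> < r"
  shows "\<exists>c0::real. c0 > 0 \<and> (\<forall>\<kappa>::real. \<kappa> \<ge> 0 \<longrightarrow>
    (\<exists>N0::real. \<exists>s0::real. N0 > 0 \<and> s0 > 0 \<and>
      (\<forall>(m::int) (n::int) (s::real) (\<xi>::real \<times> real) (M::'a measure) \<omega> I J.
         (real_of_int m, real_of_int n) \<in> cone_S \<delta> \<longrightarrow>
         real_of_int m \<ge> N0 \<longrightarrow> real_of_int n \<ge> N0 \<longrightarrow>
         s \<ge> s0 \<longrightarrow>
         \<xi> \<in> riU \<longrightarrow>
         \<delta> < fst \<xi> \<longrightarrow> fst \<xi> < 1 - \<delta> \<longrightarrow>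
         \<bar>fst \<xi> - real_of_int m / real_of_int (m + n)\<bar> \<le> \<kappa> * real_of_int (m + n) powr (- 1 / 3) \<longrightarrow>
         stationary_lpp M r \<xi> \<omega> I J \<longrightarrow>
         measure M {x \<in> space M.
             max \<bar>real_of_int (Z1 (\<lambda>v. \<omega> v x) (\<lambda>v. I v x) (\<lambda>v. J v x) m n)\<bar>
                 \<bar>real_of_int (Z2 (\<lambda>v. \<omega> v x) (\<lambda>v. I v x) (\<lambda>v. J v x) m n)\<bar>
               \<ge> s * real_of_int (m + n) powr (2 / 3)}
           \<le> exp (- c0 * s ^ 3))))"
proof -
  \<comment> \<open>The cone condition puts \<open>m / (m + n)\<close> into
    \<open>[d, 1 - d]\<close>, and \<open>d \<le> \<delta>\<close> puts the first coordinate of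
    \<xi> there too.\<close>
  define d where "d = \<delta> / (1 + \<delta>)"
  have d: "0 < d" "d < 1" "d \<le> \<delta>" using assms by (auto simp: d_def field_simps)
  obtain \<tau>0 \<Lambda> where \<tau>0: "0 < \<tau>0" "\<tau>0 \<le> 1" "0 < \<Lambda>"
    and range: "\<And>x. d \<le> x \<Longrightarrow> x \<le> 1 - d \<Longrightarrow> r + \<tau>0 \<le> pbar r (x, 1 - x) \<and> pbar r (x, 1 - x) \<le> 1 - \<tau>0"
    and lip: "\<And>x y. d \<le> x \<Longrightarrow> x \<le> 1 - d \<Longrightarrow> d \<le> y \<Longrightarrow> y \<le> 1 - d \<Longrightarrow>
      \<bar>pbar r (x, 1 - x) - pbar r (y, 1 - y)\<bar> \<le> \<Lambda> * \<bar>x - y\<bar>"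
    using pbar_bounds[OF assms(1,2) d(1,2)] by metis
  \<comment> \<open>One margin for the parameter \<open>p0\<close> and for its reflection
    \<open>r / p0\<close>, whose distance from \<open>r\<close> shrinks by the factor
    \<open>r\<close>.\<close>
  define \<tau> where "\<tau> = r * \<tau>0"
  have \<tau>: "0 < \<tau>" "\<tau> \<le> \<tau>0" "\<tau> \<le> 1"
  proof -
    have "r * \<tau>0 \<le> 1 * \<tau>0" using assms \<tau>0 by (intro mult_right_mono) auto
    then show "\<tau> \<le> \<tau>0" "\<tau> \<le> 1" using \<tau>0 unfolding \<tau>_def by linarith+
  qed (use assms \<tau>0 in \<open>simp add: \<tau>_def\<close>)
  define \<beta> where "\<beta> = r * \<tau> ^ 4 / 128"
  define \<gamma> where "\<gamma> = r * \<beta> / 16"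
  define \<eta> where "\<eta> = \<gamma> * r * \<tau>\<^sup>2 / 288"
  define c where "c = \<eta> * \<gamma> / 8"
  have pos: "0 < \<beta>" "0 < \<gamma>" "0 < \<eta>" "0 < c"
    using assms \<tau> by (simp_all add: \<beta>_def \<gamma>_def \<eta>_def c_def)
  have \<beta>: "\<beta> \<le> \<tau> / 8"
  proof -
    have "r * \<tau> ^ 4 \<le> 1 * \<tau> ^ 1" using assms \<tau> by (intro mult_mono power_decreasing) auto
    then show ?thesis using \<tau> by (simp add: \<beta>_def)
  qed
  note tail = exits_after_tail[OF assms(1,2) \<tau>(1,3) pos(1) \<beta> eq_refl[OF \<beta>_def] \<gamma>_def pos(3) eq_refl[OF \<eta>_def] c_def]
  show ?thesis
  \<comment> \<open>Passing from \<open>s\<close> to \<open>l\<close> costs a factor 8 in the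
    exponent, and absorbing the sum over the two axes costs another factor 2.\<close>
  proof (rule exI[of _ "c / 16"], intro conjI allI impI)
    show "0 < c / 16" using pos by simp
    fix \<kappa> :: real assume \<kappa>: "0 \<le> \<kappa>"
    \<comment> \<open>The first term gives \<open>l > 0\<close>, the second makes the exponentials
      large enough for the constants 5 and 2, and the third puts the parameters into the window of
      width \<open>\<eta> * l / N\<close>. Only the third involves \<kappa>.\<close>
    define s0 where "s0 = 2 + 32 / c + 2 * (\<Lambda> * \<kappa>) / (r * \<eta>)"
    have "0 \<le> 32 / c" "0 \<le> 2 * (\<Lambda> * \<kappa>) / (r * \<eta>)"
      using pos assms \<tau>0 \<kappa> by simp_all
    then have s0: "0 < s0" "2 \<le> s0" "32 / c \<le> s0" "2 * (\<Lambda> * \<kappa>) / (r * \<eta>) \<le> s0"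
      unfolding s0_def by linarith+
    show "\<exists>N0 s0. 0 < N0 \<and> 0 < s0 \<and>
      (\<forall>(m::int) (n::int) (s::real) (\<xi>::real \<times> real) (M::'a measure) \<omega> I J.
         (real_of_int m, real_of_int n) \<in> cone_S \<delta> \<longrightarrow>
         real_of_int m \<ge> N0 \<longrightarrow> real_of_int n \<ge> N0 \<longrightarrow>
         s \<ge> s0 \<longrightarrow>
         \<xi> \<in> riU \<longrightarrow>
         \<delta> < fst \<xi> \<longrightarrow> fst \<xi> < 1 - \<delta> \<longrightarrow>
         \<bar>fst \<xi> - real_of_int m / real_of_int (m + n)\<bar> \<le> \<kappa> * real_of_int (m + n) powr (- 1 / 3) \<longrightarrow>
         stationary_lpp M r \<xi> \<omega> I J \<longrightarrow>
         measure M {x \<in> space M.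
             max \<bar>real_of_int (Z1 (\<lambda>v. \<omega> v x) (\<lambda>v. I v x) (\<lambda>v. J v x) m n)\<bar>
                 \<bar>real_of_int (Z2 (\<lambda>v. \<omega> v x) (\<lambda>v. I v x) (\<lambda>v. J v x) m n)\<bar>
               \<ge> s * real_of_int (m + n) powr (2 / 3)}
           \<le> exp (- (c / 16) * s ^ 3))"
    proof (rule exI[of _ 1], rule exI[of _ s0], intro conjI allI impI)
      fix m' n' :: int and s :: real and \<xi> :: "real \<times> real" and M :: "'a measure" and \<omega> I J
      assume cone: "(real_of_int m', real_of_int n') \<in> cone_S \<delta>"
        and m1: "1 \<le> real_of_int m'" and n1: "1 \<le> real_of_int n'" and s: "s0 \<le> s"
        and riU: "\<xi> \<in> riU" and \<xi>: "\<delta> < fst \<xi>" "fst \<xi> < 1 - \<delta>"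
        and near: "\<bar>fst \<xi> - real_of_int m' / real_of_int (m' + n')\<bar> \<le> \<kappa> * real_of_int (m' + n') powr (- 1 / 3)"
        and lpp: "stationary_lpp M r \<xi> \<omega> I J"
      interpret stationary_lpp M r \<xi> \<omega> I J by (rule lpp)
      define m n where "m = nat m'" and "n = nat n'"
      have mn: "m' = int m" "n' = int n" "0 < m" "0 < n" using m1 n1 by (auto simp: m_def n_def)
      define N where "N = real m + real n"
      define T where "T = N powr (2 / 3)"
      define x where "x = m / N"
      define p0 where "p0 = pbar r (x, 1 - x)"
      define p where "p = pbar r \<xi>"
      have N: "1 \<le> N" "real_of_int (m' + n') = N" using mn by (auto simp: N_def)
      have T: "1 \<le> T" "T ^ 3 = N\<^sup>2" "N powr (- 1 / 3) = T / N"
      proof -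
        show "1 \<le> T" using N by (simp add: T_def ge_one_powr_ge_zero)
        have "T ^ 3 = N powr (2 / 3 * real 3)" using N unfolding T_def by (subst powr_powr[symmetric]) (simp add: powr_numeral)
        then show "T ^ 3 = N\<^sup>2" using N by (simp add: powr_numeral)
        have "N powr (- 1 / 3) = N powr (2 / 3 - 1)" by simp
        also have "\<dots> = T / N" using N unfolding T_def by (subst powr_diff) simp
        finally show "N powr (- 1 / 3) = T / N" .
      qed
      have \<xi>_eq: "\<xi> = (fst \<xi>, 1 - fst \<xi>)" using riU by (auto simp: riU_def)
      have \<xi>d: "d \<le> fst \<xi>" "fst \<xi> \<le> 1 - d" using \<xi> d by auto
      have xd: "d \<le> x" "x \<le> 1 - d"
      proof -
        have "\<delta> * n \<le> m" "\<delta> * m \<le> n" using cone mn by (auto simp: cone_S_def)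
        then have "\<delta> * N \<le> m * (1 + \<delta>)" "\<delta> * N \<le> n * (1 + \<delta>)" by (auto simp: N_def algebra_simps)
        then have "d \<le> m / N" "d \<le> n / N" using assms N by (auto simp: d_def field_simps)
        moreover have "m / N = 1 - n / N" using N by (simp add: N_def field_simps)
        ultimately show "d \<le> x" "x \<le> 1 - d" by (auto simp: x_def)
      qed
      have p0: "r + \<tau>0 \<le> p0" "p0 \<le> 1 - \<tau>0" and p: "r + \<tau>0 \<le> p" "p \<le> 1 - \<tau>0"
        using range[OF xd] range[OF \<xi>d] \<xi>_eq by (auto simp: p0_def p_def)
      have eq: "m * (p0 - r)\<^sup>2 = n * r * (1 - p0)\<^sup>2"
      proof -
        have "x * (p0 - r)\<^sup>2 = (1 - x) * r * (1 - p0)\<^sup>2"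
          unfolding p0_def by (rule pbar_critical) (use assms d xd in auto)
        moreover have "real m = N * x" "real n = N * (1 - x)" using N by (auto simp: x_def N_def field_simps)
        ultimately show ?thesis by (simp add: mult.assoc)
      qed
      have close: "\<bar>p - p0\<bar> \<le> \<Lambda> * \<kappa> * (T / N)"
      proof -
        have "\<bar>p - p0\<bar> \<le> \<Lambda> * \<bar>fst \<xi> - x\<bar>"
          using lip[OF \<xi>d xd] \<xi>_eq by (simp add: p_def p0_def)
        also have "\<dots> \<le> \<Lambda> * (\<kappa> * (T / N))"
          using near \<tau>0 N T mn by (intro mult_left_mono) (auto simp: x_def)
        finally show ?thesis by simp
      qed
      \<comment> \<open>The largest integer strictly below \<open>s * T\<close>; since
        \<open>s * T \<ge> 2\<close>, it is at least half of it.\<close>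
      define l where "l = nat (\<lceil>s * T\<rceil> - 1)"
      have sT: "2 \<le> s * T" using mult_mono[of 2 s 1 T] s s0 T by simp
      have l: "real l < s * T" "s * T / 2 \<le> real l" "0 < l"
      proof -
        have "real l = real_of_int \<lceil>s * T\<rceil> - 1" using sT by (simp add: l_def)
        then show "real l < s * T" "s * T / 2 \<le> real l" "0 < l" using sT by linarith+
      qed
      have ratio: "s / 2 * (T / N) \<le> l / N" using l N by (simp add: field_simps)
      have cube: "s ^ 3 / 8 \<le> real l ^ 3 / N\<^sup>2"
      proof -
        have "(s * T / 2) ^ 3 \<le> real l ^ 3" using l sT by (intro power_mono) auto
        then have "(s * T / 2) ^ 3 / N\<^sup>2 \<le> real l ^ 3 / N\<^sup>2" by (intro divide_right_mono) auto
        moreover have "(s * T / 2) ^ 3 = s ^ 3 / 8 * N\<^sup>2"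
          by (simp add: power_mult_distrib power_divide T)
        ultimately show ?thesis using N by simp
      qed
      have s3: "32 \<le> c * s ^ 3"
      proof -
        have "s ^ 1 \<le> s ^ 3" using s s0 by (intro power_increasing) auto
        then have "32 / c \<le> s ^ 3" using s s0 by simp
        then show ?thesis using pos by (simp add: pos_divide_le_eq mult.commute)
      qed
      have big: "5 \<le> exp (c * (real l ^ 3 / N\<^sup>2))" "c * s ^ 3 / 8 \<le> c * (real l ^ 3 / N\<^sup>2)"
      proof -
        show le: "c * s ^ 3 / 8 \<le> c * (real l ^ 3 / N\<^sup>2)" using mult_left_mono[OF cube, of c] pos by simp
        show "5 \<le> exp (c * (real l ^ 3 / N\<^sup>2))" using exp_ge_add_one_self[of "c * (real l ^ 3 / N\<^sup>2)"] le s3 by linarith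
      qed
      \<comment> \<open>The division by \<open>r\<close> makes room for the reflected parameter:
        \<open>r / p\<close> and \<open>r / p0\<close> differ by at most
        \<open>\<bar>p - p0\<bar> / r\<close>.\<close>
      have dist: "\<bar>p - p0\<bar> / r \<le> \<eta> * (l / N)"
      proof -
        have "2 * (\<Lambda> * \<kappa>) / (r * \<eta>) \<le> s" using s s0(4) by linarith
        then have "2 * (\<Lambda> * \<kappa>) \<le> s * (r * \<eta>)" using pos assms by (simp add: pos_divide_le_eq)
        then have "\<Lambda> * \<kappa> / r \<le> \<eta> * (s / 2)" using assms by (simp add: field_simps)
        then have "\<Lambda> * \<kappa> / r * (T / N) \<le> \<eta> * (s / 2) * (T / N)" using N T by (intro mult_right_mono) auto
        also have "\<dots> = \<eta> * (s / 2 * (T / N))" by simp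
        also have "\<dots> \<le> \<eta> * (l / N)" using ratio pos by (intro mult_left_mono) auto
        finally have "\<Lambda> * \<kappa> / r * (T / N) \<le> \<eta> * (l / N)" .
        moreover have "\<bar>p - p0\<bar> / r \<le> \<Lambda> * \<kappa> * (T / N) / r" using close assms by (intro divide_right_mono) auto
        ultimately show ?thesis by (simp add: mult.commute)
      qed
      have r0: "0 < p" "0 < p0" "r \<le> p" "r \<le> p0" using p p0 assms \<tau>0 by auto
      have hor: "measure_pmf.prob (lpp_pmf r p (r / p) m n) {X. exits_after X m n l} \<le> exp (- c * (real l ^ 3 / N\<^sup>2))"
      proof -
        have "\<bar>p - p0\<bar> \<le> \<bar>p - p0\<bar> / r" using assms by (simp add: pos_le_divide_eq mult_left_le)
        then have "\<bar>p - p0\<bar> \<le> \<eta> * (l / N)" using dist by linarith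
        then show ?thesis
          unfolding N_def using p0 \<tau> eq l big by (intro tail[of p0]) (auto simp: N_def)
      qed
      \<comment> \<open>The reflected model has horizontal parameter \<open>r / p\<close> and
        vertical parameter \<open>p = r / (r / p)\<close>; the characteristic parameter of
        \<open>(n, m)\<close> is \<open>r / p0\<close>.\<close>
      have ver: "measure_pmf.prob (lpp_pmf r (r / p) p n m) {X. exits_after X n m l} \<le> exp (- c * (real l ^ 3 / N\<^sup>2))"
      proof -
        have pp: "p = r / (r / p)" using assms r0 by simp
        have N': "N = real n + real m" by (simp add: N_def)
        have "\<bar>r / p - r / p0\<bar> \<le> \<bar>p - p0\<bar> / r"
        proof -
          have "r / p - r / p0 = r * (p0 - p) / (p * p0)" using r0 by (simp add: field_simps)
          then have "\<bar>r / p - r / p0\<bar> = r * \<bar>p - p0\<bar> / (p * p0)"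
            using r0 assms by (simp add: abs_mult abs_minus_commute)
          also have "\<dots> \<le> r * \<bar>p - p0\<bar> / (r * r)" using r0 assms by (intro divide_left_mono mult_mono) auto
          finally show ?thesis using assms by simp
        qed
        then have near': "\<bar>r / p - r / p0\<bar> \<le> \<eta> * (l / N)" using dist by linarith
        have lo: "r + \<tau> \<le> r / p0"
        proof -
          have "r * (p0 * (1 + \<tau>0)) \<le> r * 1"
          proof (rule mult_left_mono)
            have "p0 * (1 + \<tau>0) \<le> (1 - \<tau>0) * (1 + \<tau>0)" using p0 \<tau>0 by (intro mult_right_mono) auto
            also have "\<dots> \<le> 1" using \<tau>0 by (simp add: algebra_simps)
            finally show "p0 * (1 + \<tau>0) \<le> 1" .
          qed (use assms in simp)
          then show ?thesis using r0 by (simp add: \<tau>_def pos_le_divide_eq algebra_simps)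
        qed
        have hi: "r / p0 \<le> 1 - \<tau>"
        proof -
          have "r + \<tau> * p0 \<le> r + \<tau>0 * 1" using \<tau> \<tau>0 p0 r0 by (intro add_left_mono mult_mono) auto
          then have "r \<le> (1 - \<tau>) * p0" using p0 by (simp add: algebra_simps)
          then show ?thesis using r0 by (simp add: pos_divide_le_eq)
        qed
        have eq': "n * (r / p0 - r)\<^sup>2 = m * r * (1 - r / p0)\<^sup>2"
        proof -
          have 1: "r / p0 - r = r * (1 - p0) / p0" "1 - r / p0 = (p0 - r) / p0" using r0 by (auto simp: field_simps)
          have "n * (r * (1 - p0) / p0)\<^sup>2 = (n * r * (1 - p0)\<^sup>2) * (r / p0\<^sup>2)"
            by (simp add: power2_eq_square)
          also have "\<dots> = m * r * ((p0 - r) / p0)\<^sup>2"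
            unfolding eq[symmetric] by (simp add: power2_eq_square)
          finally show ?thesis unfolding 1 .
        qed
        have "measure_pmf.prob (lpp_pmf r (r / p) (r / (r / p)) n m) {X. exits_after X n m l} \<le> exp (- c * (real l ^ 3 / N\<^sup>2))"
          unfolding N' using lo hi eq' l big near' by (intro tail[of "r / p0"]) (auto simp: N')
        then show ?thesis using pp by simp
      qed
      have "prob {x \<in> space M.
             max \<bar>real_of_int (Z1 (\<lambda>v. \<omega> v x) (\<lambda>v. I v x) (\<lambda>v. J v x) m' n')\<bar>
                 \<bar>real_of_int (Z2 (\<lambda>v. \<omega> v x) (\<lambda>v. I v x) (\<lambda>v. J v x) m' n')\<bar>
               \<ge> s * real_of_int (m' + n') powr (2 / 3)} \<le> 2 * exp (- c * (real l ^ 3 / N\<^sup>2))"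
        using prob_exit_point_le[OF mn(3,4) l(1)] hor ver
        unfolding p_def N(2) T_def[symmetric] unfolding mn(1,2) by linarith
      also have "\<dots> \<le> 2 * exp (- (c * s ^ 3 / 8))" using big(2) by simp
      also have "\<dots> \<le> exp (c * s ^ 3 / 16) * exp (- (c * s ^ 3 / 8))"
      proof (rule mult_right_mono)
        show "2 \<le> exp (c * s ^ 3 / 16)"
          using exp_ge_add_one_self[of "c * s ^ 3 / 16"] s3 by linarith
      qed simp
      also have "\<dots> = exp (- (c / 16) * s ^ 3)" by (simp add: exp_add[symmetric])
      finally show "prob {x \<in> space M.
             max \<bar>real_of_int (Z1 (\<lambda>v. \<omega> v x) (\<lambda>v. I v x) (\<lambda>v. J v x) m' n')\<bar>
                 \<bar>real_of_int (Z2 (\<lambda>v. \<omega> v x) (\<lambda>v. I v x) (\<lambda>v. J v x) m' n')\<bar>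
               \<ge> s * real_of_int (m' + n') powr (2 / 3)} \<le> exp (- (c / 16) * s ^ 3)" .
    qed (use s0 in auto)
  qed
qed

end
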